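(* Let $\mathbb{M}$ be a monster model of some theory and $K$ a definable field in $\mathbb{M}$. Suppose that to every definable $X\subseteq K^n$ is assigned $\dim(X)\in\mathbb{N}\cup\{-\infty\}$ such that: (1) $\dim(X)=-\infty$ iff $X=\emptyset$; (2) $\dim(K)>0$; (3) if $\dim(X)>0$ then $X$ is infinite; (4) $\dim(X\times Y)=\dim(X)+\dim(Y)$; (5) $\dim(X\cup Y)=\max(\dim X,\dim Y)$; (6) if $f:X\to Y$ is a definable surjection with finite fibers then $\dim(X)=\dim(Y)$. Suppose $\tau$ is a definable field topology on $K$ such that (7) for definable $X\subseteq K^n$, $\dim(X)=\dim(K^n)$ iff $X$ has non-empty interior in $K^n$; and (8) whenever $U\subseteq K^n$ is a non-empty definable open set and $f:U\rightrightarrows K^m$ is a definable $k$-correspondence, the set of points of $U$ at which $f$ is not continuous has dimension $<\dim(K^n)$. Then $\tau$ is st-henselian.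
   Context: "Definable" means definable with parameters in $\mathbb{M}$; a topology is definable if it has a basis given by a definable family; a field topology is one in which the field operations are continuous; $K^n$ carries the product topology. A $k$-correspondence $f:X\rightrightarrows Y$ assigns to each $x\in X$ a $k$-element subset $f(x)\subseteq Y$; it is definable if its graph $\{(x,y):y\in f(x)\}$ is definable; it is continuous at $a$ if there is a neighborhood $U$ of $a$ and continuous functions $g_1,\dots,g_k:U\to Y$ with $f(x)=\{g_1(x),\dots,g_k(x)\}$ on $U$. Let $K[X]^d_1$ be the monic degree-$d$ polynomials over $K$, topologized as $K^d$ via coefficients. $\tau$ is st-henselian (silver t-henselian) if whenever $Q\in K[X]^d_1$ is separable and has a root $a\in K$, for every neighborhood $U$ of $a$ there is a neighborhood $V$ of $Q$ in $K[X]^d_1$ such that every $P\in V$ has a root in $U$. *)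

theory Defs
  imports
    "HOL-Analysis.Analysis"
    "HOL-Library.Extended"
    "HOL-Algebra.Algebraic_Closure_Type"
begin

unbundle cardinal_syntax

record ('f, 'r) signature =
  fun_arity :: "'f \<Rightarrow> nat"
  rel_arity :: "'r \<Rightarrow> nat"

datatype 'f fo_term = Var nat | Fn 'f "'f fo_term list"

datatype ('f, 'r) fo_form =
    Eq "'f fo_term" "'f fo_term"
  | Rel 'r "'f fo_term list"
  | Neg "('f, 'r) fo_form"
  | Conj "('f, 'r) fo_form" "('f, 'r) fo_form"
  | Exists nat "('f, 'r) fo_form"

primrec term_vars :: "'f fo_term \<Rightarrow> nat set" where
  "term_vars (Var i) = {i}"
| "term_vars (Fn f ts) = \<Union> (set (map term_vars ts))"

primrec free_vars :: "('f, 'r) fo_form \<Rightarrow> nat set" where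
  "free_vars (Eq s t) = term_vars s \<union> term_vars t"
| "free_vars (Rel r ts) = \<Union> (set (map term_vars ts))"
| "free_vars (Neg \<phi>) = free_vars \<phi>"
| "free_vars (Conj \<phi> \<psi>) = free_vars \<phi> \<union> free_vars \<psi>"
| "free_vars (Exists i \<phi>) = free_vars \<phi> - {i}"

primrec wf_term :: "('f, 'r) signature \<Rightarrow> 'f fo_term \<Rightarrow> bool" where
  "wf_term L (Var i) \<longleftrightarrow> True"
| "wf_term L (Fn f ts) \<longleftrightarrow> length ts = fun_arity L f \<and> list_all (\<lambda>b. b) (map (wf_term L) ts)"

primrec wf_form :: "('f, 'r) signature \<Rightarrow> ('f, 'r) fo_form \<Rightarrow> bool" where
  "wf_form L (Eq s t) \<longleftrightarrow> wf_term L s \<and> wf_term L t"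
| "wf_form L (Rel r ts) \<longleftrightarrow> length ts = rel_arity L r \<and> list_all (wf_term L) ts"
| "wf_form L (Neg \<phi>) \<longleftrightarrow> wf_form L \<phi>"
| "wf_form L (Conj \<phi> \<psi>) \<longleftrightarrow> wf_form L \<phi> \<and> wf_form L \<psi>"
| "wf_form L (Exists i \<phi>) \<longleftrightarrow> wf_form L \<phi>"

text \<open>The universe of a structure is the whole type \<open>'m\<close>.  The interpretation of a symbol matters
  only on argument lists whose length is its arity.\<close>

record ('f, 'r, 'm) fo_structure =
  sig_of :: "('f, 'r) signature"
  interp_fun :: "'f \<Rightarrow> 'm list \<Rightarrow> 'm"
  interp_rel :: "'r \<Rightarrow> 'm list \<Rightarrow> bool"

primrec eval_term :: "('f, 'r, 'm) fo_structure \<Rightarrow> (nat \<Rightarrow> 'm) \<Rightarrow> 'f fo_term \<Rightarrow> 'm" where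
  "eval_term M v (Var i) = v i"
| "eval_term M v (Fn f ts) = interp_fun M f (map (eval_term M v) ts)"

primrec sat :: "('f, 'r, 'm) fo_structure \<Rightarrow> (nat \<Rightarrow> 'm) \<Rightarrow> ('f, 'r) fo_form \<Rightarrow> bool" where
  "sat M v (Eq s t) \<longleftrightarrow> eval_term M v s = eval_term M v t"
| "sat M v (Rel r ts) \<longleftrightarrow> interp_rel M r (map (eval_term M v) ts)"
| "sat M v (Neg \<phi>) \<longleftrightarrow> \<not> sat M v \<phi>"
| "sat M v (Conj \<phi> \<psi>) \<longleftrightarrow> sat M v \<phi> \<and> sat M v \<psi>"
| "sat M v (Exists i \<phi>) \<longleftrightarrow> (\<exists>a. sat M (v(i := a)) \<phi>)"

definition models_theory :: "('f, 'r, 'm) fo_structure \<Rightarrow> ('f, 'r) fo_form set \<Rightarrow> bool" where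
  "models_theory M T \<longleftrightarrow>
     (\<forall>\<phi>\<in>T. wf_form (sig_of M) \<phi> \<and> free_vars \<phi> = {} \<and> (\<forall>v. sat M v \<phi>))"


text \<open>A pair \<open>(\<phi>, v)\<close> stands for the formula in the single free variable \<open>0\<close> obtained from \<open>\<phi>\<close> by
  substituting the parameter \<open>v i\<close> for every free variable \<open>i \<noteq> 0\<close>.\<close>

definition formula_over ::
  "('f, 'r, 'm) fo_structure \<Rightarrow> 'm set \<Rightarrow> ('f, 'r) fo_form \<times> (nat \<Rightarrow> 'm) \<Rightarrow> bool" where
  "formula_over M A = (\<lambda>(\<phi>, v). wf_form (sig_of M) \<phi> \<and> (\<forall>i\<in>free_vars \<phi> - {0}. v i \<in> A))"

definition realizes ::
  "('f, 'r, 'm) fo_structure \<Rightarrow> 'm \<Rightarrow> (('f, 'r) fo_form \<times> (nat \<Rightarrow> 'm)) set \<Rightarrow> bool" where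
  "realizes M a p \<longleftrightarrow> (\<forall>(\<phi>, v)\<in>p. sat M (v(0 := a)) \<phi>)"

definition saturated :: "('f, 'r, 'm) fo_structure \<Rightarrow> 'c rel \<Rightarrow> bool" where
  "saturated M \<kappa> \<longleftrightarrow>
     (\<forall>A p. |A| <o \<kappa> \<and> (\<forall>\<theta>\<in>p. formula_over M A \<theta>) \<and>
        (\<forall>q\<subseteq>p. finite q \<longrightarrow> (\<exists>a. realizes M a q)) \<longrightarrow> (\<exists>a. realizes M a p))"

definition partial_elementary ::
  "('f, 'r, 'm) fo_structure \<Rightarrow> 'm set \<Rightarrow> ('m \<Rightarrow> 'm) \<Rightarrow> bool" where
  "partial_elementary M A h \<longleftrightarrow>
     (\<forall>\<phi> v. wf_form (sig_of M) \<phi> \<and> (\<forall>i\<in>free_vars \<phi>. v i \<in> A) \<longrightarrow>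
        sat M v \<phi> = sat M (h \<circ> v) \<phi>)"

definition automorphism :: "('f, 'r, 'm) fo_structure \<Rightarrow> ('m \<Rightarrow> 'm) \<Rightarrow> bool" where
  "automorphism M \<sigma> \<longleftrightarrow> bij \<sigma> \<and>
     (\<forall>f xs. length xs = fun_arity (sig_of M) f \<longrightarrow>
        \<sigma> (interp_fun M f xs) = interp_fun M f (map \<sigma> xs)) \<and>
     (\<forall>r xs. length xs = rel_arity (sig_of M) r \<longrightarrow>
        interp_rel M r (map \<sigma> xs) = interp_rel M r xs)"

definition strongly_homogeneous :: "('f, 'r, 'm) fo_structure \<Rightarrow> 'c rel \<Rightarrow> bool" where
  "strongly_homogeneous M \<kappa> \<longleftrightarrow>
     (\<forall>A h. |A| <o \<kappa> \<and> partial_elementary M A h \<longrightarrow>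
        (\<exists>\<sigma>. automorphism M \<sigma> \<and> (\<forall>a\<in>A. \<sigma> a = h a)))"

text \<open>\<open>\<kappa>\<close> exceeds the size of the language, measured by its number of formulas (which is
  infinite because the formulas \<open>Eq (Var i) (Var j)\<close> are always well-formed).\<close>

definition monster_model ::
  "('f, 'r) fo_form set \<Rightarrow> 'c rel \<Rightarrow> ('f, 'r, 'm) fo_structure \<Rightarrow> bool" where
  "monster_model T \<kappa> M \<longleftrightarrow> models_theory M T \<and> Card_order \<kappa> \<and>
     |{\<phi>. wf_form (sig_of M) \<phi>}| <o \<kappa> \<and> saturated M \<kappa> \<and> strongly_homogeneous M \<kappa>"


text \<open>The power \<open>A\<^sup>n\<close> consists of the functions on \<open>{..<n}\<close>, extended by \<open>undefined\<close>;
  this is the carrier of the library's product topology.\<close>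

abbreviation tuples :: "nat \<Rightarrow> (nat \<Rightarrow> 'a) set" where
  "tuples n \<equiv> {..<n} \<rightarrow>\<^sub>E UNIV"

text \<open>Concatenation of an \<open>n\<close>-tuple with a tuple of any length; it identifies
  \<open>A\<^sup>n \<times> A\<^sup>m\<close> with \<open>A\<^sup>n\<^sup>+\<^sup>m\<close>.\<close>

definition tappend :: "nat \<Rightarrow> (nat \<Rightarrow> 'a) \<Rightarrow> (nat \<Rightarrow> 'a) \<Rightarrow> nat \<Rightarrow> 'a" where
  "tappend n x y = (\<lambda>i. if i < n then x i else y (i - n))"

definition tprod :: "nat \<Rightarrow> (nat \<Rightarrow> 'a) set \<Rightarrow> (nat \<Rightarrow> 'a) set \<Rightarrow> (nat \<Rightarrow> 'a) set" where
  "tprod n A B = {tappend n x y | x y. x \<in> A \<and> y \<in> B}"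

text \<open>Definability is with parameters: the variables \<open>i \<ge> n\<close> are evaluated at the parameters \<open>c\<close>.\<close>

definition definable :: "('f, 'r, 'm) fo_structure \<Rightarrow> nat \<Rightarrow> (nat \<Rightarrow> 'm) set \<Rightarrow> bool" where
  "definable M n D \<longleftrightarrow>
     (\<exists>\<phi> c. wf_form (sig_of M) \<phi> \<and>
        D = {x \<in> tuples n. sat M (\<lambda>i. if i < n then x i else c i) \<phi>})"

text \<open>A definable field \<open>K \<subseteq> M\<^sup>e\<close> is presented as a field type \<open>'k\<close> together with the inclusion
  \<open>\<iota> : K \<rightarrow> M\<^sup>e\<close>, so that \<open>K\<close> is the range of \<open>\<iota>\<close>.  Under \<open>\<iota>\<close> the power \<open>K\<^sup>n\<close> is identified with a subset of \<open>M\<^sup>n\<^sup>e\<close>.\<close>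

definition embed_power :: "nat \<Rightarrow> ('k \<Rightarrow> nat \<Rightarrow> 'm) \<Rightarrow> nat \<Rightarrow> (nat \<Rightarrow> 'k) \<Rightarrow> nat \<Rightarrow> 'm" where
  "embed_power e \<iota> n x = (\<lambda>j\<in>{..<n * e}. \<iota> (x (j div e)) (j mod e))"

definition definable_in_power ::
  "('f, 'r, 'm) fo_structure \<Rightarrow> nat \<Rightarrow> ('k \<Rightarrow> nat \<Rightarrow> 'm) \<Rightarrow> nat \<Rightarrow> (nat \<Rightarrow> 'k) set \<Rightarrow> bool" where
  "definable_in_power M e \<iota> n A \<longleftrightarrow>
     A \<subseteq> tuples n \<and> definable M (n * e) (embed_power e \<iota> n ` A)"

definition definable_field ::
  "('f, 'r, 'm) fo_structure \<Rightarrow> nat \<Rightarrow> ('k::field \<Rightarrow> nat \<Rightarrow> 'm) \<Rightarrow> bool" where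
  "definable_field M e \<iota> \<longleftrightarrow>
     inj \<iota> \<and> definable M e (range \<iota>) \<and>
     definable_in_power M e \<iota> 3 {x \<in> tuples 3. x 0 + x 1 = x 2} \<and>
     definable_in_power M e \<iota> 3 {x \<in> tuples 3. x 0 * x 1 = x 2}"

definition tgraph ::
  "nat \<Rightarrow> (nat \<Rightarrow> 'k) set \<Rightarrow> ((nat \<Rightarrow> 'k) \<Rightarrow> (nat \<Rightarrow> 'k) set) \<Rightarrow> (nat \<Rightarrow> 'k) set" where
  "tgraph n A f = {tappend n x y | x y. x \<in> A \<and> y \<in> f x}"


abbreviation power_topology :: "'k topology \<Rightarrow> nat \<Rightarrow> (nat \<Rightarrow> 'k) topology" where
  "power_topology \<tau> n \<equiv> product_topology (\<lambda>_. \<tau>) {..<n}"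

definition field_topology :: "'k::field topology \<Rightarrow> bool" where
  "field_topology \<tau> \<longleftrightarrow> topspace \<tau> = UNIV \<and>
     continuous_map (prod_topology \<tau> \<tau>) \<tau> (\<lambda>(x, y). x + y) \<and>
     continuous_map (prod_topology \<tau> \<tau>) \<tau> (\<lambda>(x, y). x * y) \<and>
     continuous_map \<tau> \<tau> uminus \<and>
     continuous_map (subtopology \<tau> (- {0})) \<tau> inverse"

definition definable_topology ::
  "('f, 'r, 'm) fo_structure \<Rightarrow> nat \<Rightarrow> ('k \<Rightarrow> nat \<Rightarrow> 'm) \<Rightarrow> 'k topology \<Rightarrow> bool" where
  "definable_topology M e \<iota> \<tau> \<longleftrightarrow>
     (\<exists>p B W. definable M p B \<and>
        definable M (e + p) {tappend e (\<iota> x) b | x b. b \<in> B \<and> x \<in> W b} \<and>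
        (\<forall>b\<in>B. openin \<tau> (W b)) \<and>
        (\<forall>U x. openin \<tau> U \<and> x \<in> U \<longrightarrow> (\<exists>b\<in>B. x \<in> W b \<and> W b \<subseteq> U)))"


definition correspondence ::
  "nat \<Rightarrow> 'a set \<Rightarrow> 'b set \<Rightarrow> ('a \<Rightarrow> 'b set) \<Rightarrow> bool" where
  "correspondence k A B f \<longleftrightarrow> (\<forall>x\<in>A. f x \<subseteq> B \<and> finite (f x) \<and> card (f x) = k)"

text \<open>\<open>S\<close> and \<open>T\<close> are topologies whose underlying spaces are the source and the target.\<close>

definition correspondence_continuous_at ::
  "nat \<Rightarrow> 'a topology \<Rightarrow> 'b topology \<Rightarrow> ('a \<Rightarrow> 'b set) \<Rightarrow> 'a \<Rightarrow> bool" where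
  "correspondence_continuous_at k S T f a \<longleftrightarrow>
     (\<exists>N g. openin S N \<and> a \<in> N \<and>
        (\<forall>i<k. continuous_map (subtopology S N) T (g i)) \<and>
        (\<forall>x\<in>N. f x = {g i x | i. i < k}))"


definition monic_polys :: "nat \<Rightarrow> 'k::field poly set" where
  "monic_polys d = {P. Polynomial.degree P = d \<and> Polynomial.lead_coeff P = 1}"

definition monic_poly_topology :: "'k::field topology \<Rightarrow> nat \<Rightarrow> 'k poly topology" where
  "monic_poly_topology \<tau> d =
     pullback_topology (monic_polys d) (\<lambda>P. \<lambda>i\<in>{..<d}. Polynomial.coeff P i) (power_topology \<tau> d)"

text \<open>Separable: all roots in the algebraic closure are simple.\<close>

definition separable_poly :: "'k::field poly \<Rightarrow> bool" where
  "separable_poly P \<longleftrightarrow> Polynomial.rsquarefree (map_poly to_ac P)"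

definition st_henselian :: "'k::field topology \<Rightarrow> bool" where
  "st_henselian \<tau> \<longleftrightarrow>
     (\<forall>d Q a. Q \<in> monic_polys d \<and> separable_poly Q \<and> poly Q a = 0 \<longrightarrow>
        (\<forall>U. openin \<tau> U \<and> a \<in> U \<longrightarrow>
           (\<exists>V. openin (monic_poly_topology \<tau> d) V \<and> Q \<in> V \<and>
              (\<forall>P\<in>V. \<exists>b\<in>U. poly P b = 0))))"

unbundle no cardinal_syntax

end

theory Submission
  imports Defs "Jordan_Normal_Form.Char_Poly"
begin

text \<open>Call a root of a monic polynomial over \<open>K\<close> stable if it persists in the sense of
  st-henselianity.  Where the number of roots is constant, the roots form a correspondence, and this
  correspondence is discontinuous wherever some root is unstable; hence the polynomials of degree
  \<open>d\<close> with an unstable root form a definable set with empty interior.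

  Now let \<open>Q\<close> be separable of degree \<open>d\<close>.  Sending \<open>g \<in> K[x]/(Q)\<close> to its characteristic polynomial
  is finite-to-one, so the image has full dimension, hence non-empty interior, and some generator
  \<open>g\<close> has a characteristic polynomial all of whose roots are stable.  Writing \<open>x = h(g)\<close> in
  \<open>K[x]/(P)\<close> for \<open>P\<close> near \<open>Q\<close>, where \<open>h\<close> and the characteristic polynomial depend continuously on
  \<open>P\<close> by Cramer's rule, roots \<open>y\<close> of the latter yield roots \<open>h(y)\<close> of \<open>P\<close>.\<close>

section \<open>Predicates defined by formulas with parameters\<close>

text \<open>The obstacle is that empty interior says nothing about one given \<open>Q\<close>, which
  may itself lie in the unstable set. \<open>Q\<close> cannot be moved, but its presentation can:
  K[x]/(Q) has many generators, each with its own characteristic polynomial. Finiteness of the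
  fibres comes from separability, since an element of degree below d is determined by its values at
  d distinct points.

  Being a generator is the non-vanishing of a determinant, which is an open condition once {0} is
  closed. This is not part of the notion of a field topology and has to be extracted from the
  dimension axioms.

  Those axioms speak of definable sets, so the unstable set, the sets with a fixed number of roots,
  and the graph and image of the characteristic polynomial map must be shown definable. Formulas are
  handled semantically, through classes of predicates closed under connectives and under quantifiers
  over field elements and over indices of basic open sets. Functions built from sums and products
  are definable and continuous at once, so the algebra is arranged to produce only such functions,
  with a division at the very end.\<close>

lemma finite_term_vars: "finite (term_vars t)"
  by (induction t) auto

lemma finite_free_vars: "finite (free_vars \<phi>)"
  by (induction \<phi>) (auto simp: finite_term_vars)

lemma eval_term_cong:
  "(\<And>i. i \<in> term_vars t \<Longrightarrow> v i = w i) \<Longrightarrow> eval_term M v t = eval_term M w t"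
proof (induction t)
  case (Fn f ts)
  then have "map (eval_term M v) ts = map (eval_term M w) ts"
    by (intro map_cong) auto
  then show ?case by (simp only: eval_term.simps)
qed simp

lemma sat_cong:
  "(\<And>i. i \<in> free_vars \<phi> \<Longrightarrow> v i = w i) \<Longrightarrow> sat M v \<phi> = sat M w \<phi>"
proof (induction \<phi> arbitrary: v w)
  case (Eq s t)
  then show ?case using eval_term_cong[of s v w M] eval_term_cong[of t v w M] by simp
next
  case (Rel r ts)
  then have "map (eval_term M v) ts = map (eval_term M w) ts"
    by (intro map_cong eval_term_cong) auto
  then show ?case by (simp only: sat.simps)
next
  case (Neg \<phi>)
  then show ?case by (metis free_vars.simps(3) sat.simps(3))
next
  case (Conj \<phi>1 \<phi>2)
  have "sat M v \<phi>1 = sat M w \<phi>1" "sat M v \<phi>2 = sat M w \<phi>2"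
    using Conj.prems by (auto intro!: Conj.IH)
  then show ?case by simp
next
  case (Exists i \<phi>)
  have "sat M (v(i := a)) \<phi> = sat M (w(i := a)) \<phi>" for a
    using Exists.prems by (intro Exists.IH) auto
  then show ?case by simp
qed

primrec rename_term :: "(nat \<Rightarrow> nat) \<Rightarrow> 'f fo_term \<Rightarrow> 'f fo_term" where
  "rename_term \<sigma> (Var i) = Var (\<sigma> i)"
| "rename_term \<sigma> (Fn f ts) = Fn f (map (rename_term \<sigma>) ts)"

lemma wf_rename_term: "wf_term L (rename_term \<sigma> t) \<longleftrightarrow> wf_term L t"
  by (induction t) (auto simp: list_all_iff)

lemma eval_rename_term: "eval_term M v (rename_term \<sigma> t) = eval_term M (v \<circ> \<sigma>) t"
proof (induction t)
  case (Fn f ts)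
  then have "map (eval_term M v \<circ> rename_term \<sigma>) ts = map (eval_term M (v \<circ> \<sigma>)) ts"
    by (intro map_cong) (simp_all add: o_def)
  then show ?case by (simp del: comp_apply map_eq_conv)
qed simp

lemma sat_rename:
  "wf_form L \<phi> \<Longrightarrow> \<exists>\<psi>. wf_form L \<psi> \<and> (\<forall>v. sat M v \<psi> = sat M (v \<circ> \<sigma>) \<phi>)"
proof (induction \<phi> arbitrary: \<sigma>)
  case (Eq s t)
  then show ?case
    by (intro exI[of _ "Eq (rename_term \<sigma> s) (rename_term \<sigma> t)"])
       (simp add: wf_rename_term eval_rename_term del: comp_apply)
next
  case (Rel r ts)
  have "map (eval_term M v \<circ> rename_term \<sigma>) ts = map (eval_term M (v \<circ> \<sigma>)) ts" for v
    by (intro map_cong) (auto simp: eval_rename_term)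
  with Rel show ?case
    by (intro exI[of _ "Rel r (map (rename_term \<sigma>) ts)"])
       (simp add: wf_rename_term list_all_iff del: comp_apply map_eq_conv)
next
  case (Neg \<phi>)
  then obtain \<psi> where "wf_form L \<psi>" "\<forall>v. sat M v \<psi> = sat M (v \<circ> \<sigma>) \<phi>"
    by (metis wf_form.simps(3))
  then show ?case by (intro exI[of _ "Neg \<psi>"]) (simp del: comp_apply)
next
  case (Conj \<phi>1 \<phi>2)
  then obtain \<psi>1 \<psi>2 where "wf_form L \<psi>1" "\<forall>v. sat M v \<psi>1 = sat M (v \<circ> \<sigma>) \<phi>1"
    "wf_form L \<psi>2" "\<forall>v. sat M v \<psi>2 = sat M (v \<circ> \<sigma>) \<phi>2" by (metis wf_form.simps(4))
  then show ?case by (intro exI[of _ "Conj \<psi>1 \<psi>2"]) (simp del: comp_apply)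
next
  case (Exists i \<phi>)
  \<comment> \<open>The substitution \<open>\<sigma>\<close> need not be injective, so the bound
    variable is renamed to one outside the image of the free variables to avoid capture.\<close>
  obtain j where j: "j \<notin> \<sigma> ` free_vars \<phi>"
    using finite_free_vars ex_new_if_finite[OF infinite_UNIV_nat] by (metis finite_imageI)
  obtain \<psi> where \<psi>: "wf_form L \<psi>" "\<forall>v. sat M v \<psi> = sat M (v \<circ> \<sigma>(i := j)) \<phi>"
    using Exists by (metis wf_form.simps(5))
  have "sat M (v(j := a) \<circ> \<sigma>(i := j)) \<phi> = sat M ((v \<circ> \<sigma>)(i := a)) \<phi>" for v a
    using j by (intro sat_cong) auto
  then show ?case using \<psi> by (intro exI[of _ "Exists j \<psi>"]) (simp del: comp_apply)
qed

text \<open>Each variable of a formula is sent either to a coordinate of the assignment or to a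
  parameter, so that assignments may be indexed by any type.\<close>

definition mdef :: "('f, 'r, 'm) fo_structure \<Rightarrow> (('x \<Rightarrow> 'm) \<Rightarrow> bool) \<Rightarrow> bool" where
  "mdef M S \<longleftrightarrow> (\<exists>\<phi> t. wf_form (sig_of M) \<phi> \<and> (\<forall>u. S u = sat M (\<lambda>i. case_sum u id (t i)) \<phi>))"

lemma mdef_not: "mdef M S \<Longrightarrow> mdef M (\<lambda>u. \<not> S u)"
  unfolding mdef_def by (metis sat.simps(3) wf_form.simps(3))

lemma mdef_conj:
  assumes "mdef M R" "mdef M S"
  shows "mdef M (\<lambda>u. R u \<and> S u)"
proof -
  obtain \<phi> r where \<phi>: "wf_form (sig_of M) \<phi>" "\<And>u. R u = sat M (\<lambda>i. case_sum u id (r i)) \<phi>"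
    using assms unfolding mdef_def by auto
  obtain \<psi> s where \<psi>: "wf_form (sig_of M) \<psi>" "\<And>u. S u = sat M (\<lambda>i. case_sum u id (s i)) \<psi>"
    using assms unfolding mdef_def by auto
  \<comment> \<open>The two formulas may read the same variable differently; moving them to the even
    and the odd variables separates the readings.\<close>
  obtain \<phi>' where \<phi>': "wf_form (sig_of M) \<phi>'" "\<And>v. sat M v \<phi>' = sat M (v \<circ> (\<lambda>i. 2 * i)) \<phi>"
    using sat_rename[OF \<phi>(1)] by blast
  obtain \<psi>' where \<psi>': "wf_form (sig_of M) \<psi>'" "\<And>v. sat M v \<psi>' = sat M (v \<circ> (\<lambda>i. 2 * i + 1)) \<psi>"
    using sat_rename[OF \<psi>(1)] by blast
  define t where "t i = (if even i then r (i div 2) else s (i div 2))" for i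
  show ?thesis unfolding mdef_def
    by (rule exI[of _ "Conj \<phi>' \<psi>'"], rule exI[of _ t])
       (simp add: \<phi> \<psi> \<phi>' \<psi>' t_def o_def)
qed

lemma mdef_const: "mdef M (\<lambda>u. P)"
proof -
  have "mdef M (\<lambda>u. True)"
    unfolding mdef_def by (rule exI[of _ "Eq (Var 0) (Var 0)"]) simp
  from this mdef_not[OF this] show ?thesis by (cases P) auto
qed

lemma mdef_ball_finite:
  assumes "finite I" "\<And>i. i \<in> I \<Longrightarrow> mdef M (S i)"
  shows "mdef M (\<lambda>u. \<forall>i\<in>I. S i u)"
  using assms by (induction rule: finite_induct) (auto intro: mdef_conj mdef_const)

lemma mdef_subst:
  fixes f :: "'x \<Rightarrow> 'y + 'm"
  assumes "mdef M S"
  shows "mdef M (\<lambda>u. S (\<lambda>x. case_sum u id (f x)))"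
proof -
  obtain \<phi> t where \<phi>: "wf_form (sig_of M) \<phi>" "\<And>u. S u = sat M (\<lambda>i. case_sum u id (t i)) \<phi>"
    using assms unfolding mdef_def by auto
  have "case_sum (\<lambda>x. case_sum u id (f x)) id (t i) = case_sum u id (case_sum f Inr (t i))" for u i
    by (cases "t i") auto
  then show ?thesis unfolding mdef_def
    by (intro exI[of _ \<phi>] exI[of _ "\<lambda>i. case_sum f Inr (t i)"]) (simp add: \<phi>)
qed

lemma mdef_rename: "mdef M S \<Longrightarrow> mdef M (\<lambda>u. S (\<lambda>x. u (g x)))"
  using mdef_subst[of M S "\<lambda>x. Inl (g x)"] by simp

lemma mdef_ex1:
  assumes "mdef M S"
  shows "mdef M (\<lambda>u. \<exists>a. S (u(x := a)))"
proof -
  obtain \<phi> t where \<phi>: "wf_form (sig_of M) \<phi>" "\<And>u. S u = sat M (\<lambda>i. case_sum u id (t i)) \<phi>"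
    using assms unfolding mdef_def by auto
  \<comment> \<open>Several variables may read the coordinate \<open>x\<close>. They all become the
    bound variable 0, and the others move up by one.\<close>
  define \<sigma> where "\<sigma> i = (if t i = Inl x then 0 else Suc i)" for i
  obtain \<psi> where \<psi>: "wf_form (sig_of M) \<psi>" "\<And>v. sat M v \<psi> = sat M (v \<circ> \<sigma>) \<phi>"
    using sat_rename[OF \<phi>(1)] by blast
  define t' where "t' i = t (i - 1)" for i
  have "S (u(x := a)) = sat M ((\<lambda>i. case_sum u id (t' i))(0 := a)) \<psi>" for u a
    unfolding \<phi> \<psi>
    by (rule arg_cong[where f = "\<lambda>v. sat M v \<phi>"]) (auto simp: fun_eq_iff \<sigma>_def t'_def split: sum.splits)
  then show ?thesis unfolding mdef_def
    by (intro exI[of _ "Exists 0 \<psi>"] exI[of _ t']) (simp add: \<psi>)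
qed

text \<open>Elements of \<open>Z\<close> are quantified one at a time. The closure property
  \<open>C\<close> and the passive argument \<open>w\<close> are abstract so that the same induction
  serves structure elements, where \<open>w\<close> is trivial, and field elements, where
  \<open>w\<close> holds the tuple variables.\<close>

lemma finite_ex_closed:
  fixes S :: "('x \<Rightarrow> 'a) \<Rightarrow> 'w \<Rightarrow> bool"
  assumes "finite Z" "C S" and C: "\<And>S x. C S \<Longrightarrow> C (\<lambda>u w. \<exists>a. S (u(x := a)) w)"
  shows "C (\<lambda>u w. \<exists>u'. S (\<lambda>x. if x \<in> Z then u' x else u x) w)"
  using assms(1)
proof induction
  case empty
  then show ?case using assms(2) by simp
next
  case (insert x Z)
  have "(\<exists>a u'. S (\<lambda>y. if y \<in> Z then u' y else (u(x := a)) y) w) =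
        (\<exists>u'. S (\<lambda>y. if y \<in> insert x Z then u' y else u y) w)" for u w
  proof
    assume "\<exists>a u'. S (\<lambda>y. if y \<in> Z then u' y else (u(x := a)) y) w"
    then obtain a u' where *: "S (\<lambda>y. if y \<in> Z then u' y else (u(x := a)) y) w" by blast
    have "(\<lambda>y. if y \<in> Z then u' y else (u(x := a)) y) =
          (\<lambda>y. if y \<in> insert x Z then (u'(x := a)) y else u y)"
      using insert.hyps by (auto simp: fun_eq_iff)
    with * show "\<exists>u'. S (\<lambda>y. if y \<in> insert x Z then u' y else u y) w" by metis
  next
    assume "\<exists>u'. S (\<lambda>y. if y \<in> insert x Z then u' y else u y) w"
    then obtain u' where *: "S (\<lambda>y. if y \<in> insert x Z then u' y else u y) w" by blast
    have "(\<lambda>y. if y \<in> insert x Z then u' y else u y) =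
          (\<lambda>y. if y \<in> Z then u' y else (u(x := u' x)) y)"
      using insert.hyps by (auto simp: fun_eq_iff)
    with * show "\<exists>a u'. S (\<lambda>y. if y \<in> Z then u' y else (u(x := a)) y) w" by metis
  qed
  with C[OF insert.IH, of x] show ?case by simp
qed

lemma mdef_ex_finite:
  assumes "finite Z" "mdef M S"
  shows "mdef M (\<lambda>u. \<exists>u'. S (\<lambda>x. if x \<in> Z then u' x else u x))"
  by (rule finite_ex_closed[of Z "\<lambda>S. mdef M (\<lambda>u. S u ())" "\<lambda>u _. S u", OF assms(1)])
     (use assms(2) in \<open>auto intro: mdef_ex1\<close>)

text \<open>Here \<open>Z\<close> may be infinite: a formula has finitely many free variables, so
  only finitely many coordinates in \<open>Z\<close> matter. This allows quantification over a whole
  block of coordinates.\<close>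

lemma mdef_ex:
  assumes "mdef M S"
  shows "mdef M (\<lambda>u. \<exists>u'. S (\<lambda>x. if x \<in> Z then u' x else u x))"
proof -
  obtain \<phi> t where \<phi>: "wf_form (sig_of M) \<phi>" "\<And>u. S u = sat M (\<lambda>i. case_sum u id (t i)) \<phi>"
    using assms unfolding mdef_def by auto
  define Y where "Y = {x. Inl x \<in> t ` free_vars \<phi>}"
  have fin: "finite Y"
    unfolding Y_def using finite_vimageI[OF finite_imageI[OF finite_free_vars], of Inl t \<phi>]
    by (simp add: vimage_def)
  have S_cong: "S u = S u'" if "\<And>x. x \<in> Y \<Longrightarrow> u x = u' x" for u u'
    unfolding \<phi> using that by (intro sat_cong) (force simp: Y_def split: sum.splits)
  have "(\<exists>u'. S (\<lambda>x. if x \<in> Z \<inter> Y then u' x else u x)) =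
        (\<exists>u'. S (\<lambda>x. if x \<in> Z then u' x else u x))" for u
    by (intro ex_cong1 S_cong) auto
  with mdef_ex_finite[OF _ assms, of "Z \<inter> Y"] fin show ?thesis by simp
qed

lemma mdef_definable:
  assumes "definable M n D"
  shows "mdef M (\<lambda>u. restrict u {..<n} \<in> D)"
proof -
  obtain \<phi> c where \<phi>: "wf_form (sig_of M) \<phi>"
    "D = {x \<in> tuples n. sat M (\<lambda>i. if i < n then x i else c i) \<phi>}"
    using assms unfolding definable_def by auto
  define t where "t i = (if i < n then Inl i else Inr (c i))" for i
  have "(restrict u {..<n} \<in> D) = sat M (\<lambda>i. case_sum u id (t i)) \<phi>" for u
    unfolding \<phi> t_def
    by (auto intro!: arg_cong[where f = "\<lambda>v. sat M v \<phi>"] simp: fun_eq_iff elim!: back_subst[of "\<lambda>v. sat M v \<phi>"])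
  then show ?thesis using \<phi>(1) unfolding mdef_def by blast
qed

lemma definable_mdef:
  assumes "mdef M S"
  shows "definable M n {x \<in> tuples n. S x}"
proof -
  \<comment> \<open>On \<open>tuples n\<close> the coordinates from \<open>n\<close> on equal
    \<open>undefined\<close>, so they may be replaced by that parameter.\<close>
  have *: "mdef M (\<lambda>u. S (\<lambda>i. case_sum u id (if i < n then Inl i else Inr undefined)))"
    by (rule mdef_subst[OF assms])
  define S' where "S' u = S (\<lambda>i. if i < n then u i else undefined)" for u
  have "mdef M S'"
    using * by (rule back_subst[of "mdef M"]) (auto simp: S'_def fun_eq_iff intro!: arg_cong[where f = S])
  then obtain \<phi> t where \<phi>: "wf_form (sig_of M) \<phi>" "\<And>u. S' u = sat M (\<lambda>i. case_sum u id (t i)) \<phi>"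
    unfolding mdef_def by auto
  \<comment> \<open>Variables reading a coordinate below \<open>n\<close> are sent to it. Any other
    variable \<open>i\<close> receives a place \<open>n + i\<close> of its own, where
    \<open>c\<close> supplies its parameter.\<close>
  define \<sigma> where "\<sigma> i = (case t i of Inl j \<Rightarrow> if j < n then j else n + i | Inr a \<Rightarrow> n + i)" for i
  define c where "c i = (case t (i - n) of Inl j \<Rightarrow> undefined | Inr a \<Rightarrow> a)" for i
  obtain \<psi> where \<psi>: "wf_form (sig_of M) \<psi>" "\<And>v. sat M v \<psi> = sat M (v \<circ> \<sigma>) \<phi>"
    using sat_rename[OF \<phi>(1)] by blast
  have "S x = sat M (\<lambda>i. if i < n then x i else c i) \<psi>" if "x \<in> tuples n" for x
  proof -
    have "S x = S' x"
      using that unfolding S'_def by (intro arg_cong[where f = S]) (auto simp: fun_eq_iff PiE_iff extensional_def)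
    also have "\<dots> = sat M (\<lambda>i. if i < n then x i else c i) \<psi>"
      unfolding \<phi> \<psi> using that
      by (intro arg_cong[where f = "\<lambda>v. sat M v \<phi>"])
         (auto simp: fun_eq_iff \<sigma>_def c_def PiE_iff extensional_def split: sum.splits)
    finally show ?thesis .
  qed
  then have "{x \<in> tuples n. S x} = {x \<in> tuples n. sat M (\<lambda>i. if i < n then x i else c i) \<psi>}"
    by auto
  then show ?thesis using \<psi>(1) unfolding definable_def by blast
qed

section \<open>Definability over an embedded field\<close>

lemma div_mod_block: "(i * e + j) div e = i" "(i * e + j) mod e = j" if "j < e" for i e j :: nat
  using that by auto

lemma block_less: "i * e + j < n * e" if "i < n" "j < e" for i j n e :: nat
proof -
  have "i * e + j < Suc i * e" using that by simp
  also have "\<dots> \<le> n * e" using that by (intro mult_le_mono1) simp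
  finally show ?thesis .
qed

locale embedded_field =
  fixes M :: "('f, 'r, 'm) fo_structure" and e :: nat and \<iota> :: "'k::field \<Rightarrow> nat \<Rightarrow> 'm"
  assumes df: "definable_field M e \<iota>"
begin

lemma inj_emb: "inj \<iota>" and definable_range: "definable M e (range \<iota>)"
  using df unfolding definable_field_def by auto

lemma emb_in: "\<iota> x \<in> tuples e"
  using definable_range unfolding definable_def by auto

lemma emb_undef: "\<not> j < e \<Longrightarrow> \<iota> x j = undefined"
  using emb_in[of x] by (auto simp: PiE_iff extensional_def)

text \<open>Field variables are evaluated by \<open>v\<close> and tuple variables of the ambient structure by \<open>w\<close>.\<close>

definition kenv :: "(nat \<Rightarrow> 'k) \<Rightarrow> (nat \<Rightarrow> nat \<Rightarrow> 'm) \<Rightarrow> (nat \<times> nat) + (nat \<times> nat) \<Rightarrow> 'm" where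
  "kenv v w = case_sum (\<lambda>(x, j). \<iota> (v x) j) (\<lambda>(x, j). w x j)"

text \<open>Tuple variables are carried along because a definable basis of the topology is indexed
  by tuples of the ambient structure and not by field elements.\<close>

definition kdef :: "((nat \<Rightarrow> 'k) \<Rightarrow> (nat \<Rightarrow> nat \<Rightarrow> 'm) \<Rightarrow> bool) \<Rightarrow> bool" where
  "kdef R \<longleftrightarrow> (\<exists>S. mdef M S \<and> (\<forall>v w. R v w = S (kenv v w)))"

lemma kdefI: "mdef M S \<Longrightarrow> (\<And>v w. R v w = S (kenv v w)) \<Longrightarrow> kdef R"
  unfolding kdef_def by blast

lemma kdefE:
  assumes "kdef R"
  obtains S where "mdef M S" "\<And>v w. R v w = S (kenv v w)"
  using assms unfolding kdef_def by blast

lemma kdef_not: "kdef R \<Longrightarrow> kdef (\<lambda>v w. \<not> R v w)"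
  by (elim kdefE, rule kdefI[OF mdef_not]) auto

lemma kdef_conj: "kdef R \<Longrightarrow> kdef S \<Longrightarrow> kdef (\<lambda>v w. R v w \<and> S v w)"
  by (elim kdefE, rule kdefI[OF mdef_conj]) auto

lemma kdef_const: "kdef (\<lambda>v w. P)"
  by (rule kdefI[OF mdef_const]) simp

lemma kdef_imp: "kdef R \<Longrightarrow> kdef S \<Longrightarrow> kdef (\<lambda>v w. R v w \<longrightarrow> S v w)"
  using kdef_not[OF kdef_conj[OF _ kdef_not]] by simp

lemma kdef_ball_finite:
  assumes "finite I" "\<And>i. i \<in> I \<Longrightarrow> kdef (R i)"
  shows "kdef (\<lambda>v w. \<forall>i\<in>I. R i v w)"
  using assms by (induction rule: finite_induct) (auto intro: kdef_conj kdef_const)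

lemma kdef_subst:
  fixes f :: "nat \<Rightarrow> nat + 'k" and g :: "nat \<Rightarrow> nat + (nat \<Rightarrow> 'm)"
  assumes "kdef R"
  shows "kdef (\<lambda>v w. R (\<lambda>x. case_sum v id (f x)) (\<lambda>x. case_sum w id (g x)))"
proof -
  obtain S where S: "mdef M S" "\<And>v w. R v w = S (kenv v w)" using kdefE[OF assms] by metis
  show ?thesis
    by (rule kdefI, rule mdef_subst[OF S(1), of "case_sum
          (\<lambda>(x, j). case_sum (\<lambda>y. Inl (Inl (y, j))) (\<lambda>a. Inr (\<iota> a j)) (f x))
          (\<lambda>(x, j). case_sum (\<lambda>y. Inl (Inr (y, j))) (\<lambda>b. Inr (b j)) (g x))"])
       (auto simp: S(2) kenv_def fun_eq_iff intro!: arg_cong[where f = S] split: sum.splits)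
qed

lemma kdef_rename: "kdef R \<Longrightarrow> kdef (\<lambda>v w. R (\<lambda>x. v (f x)) (\<lambda>x. w (g x)))"
  using kdef_subst[of R "\<lambda>x. Inl (f x)" "\<lambda>x. Inl (g x)"] by simp

lemma kdef_fix: "kdef R \<Longrightarrow> kdef (\<lambda>v w. R (v(i := a)) w)"
  using kdef_subst[of R "\<lambda>x. if x = i then Inr a else Inl x" Inl]
  by (simp add: if_distrib[of "case_sum _ _"] fun_upd_def cong: if_cong)

lemma kdef_fix_tuples: "kdef R \<Longrightarrow> kdef (\<lambda>v w. R v w0)"
  using kdef_subst[of R Inl "\<lambda>x. Inr (w0 x)"] by simp

lemma kdef_ex:
  assumes "kdef R"
  shows "kdef (\<lambda>v w. \<exists>a. R (v(i := a)) w)"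
proof -
  obtain S where S: "mdef M S" "\<And>v w. R v w = S (kenv v w)" using kdefE[OF assms] by metis
  \<comment> \<open>A block of coordinates encodes a field element only if its first
    \<open>e\<close> entries lie in the range of \<open>\<iota>\<close> and the later ones are
    \<open>undefined\<close>. The former is imposed as a condition in \<open>S'\<close>; the latter
    is enforced by overwriting.\<close>
  define trim where "trim u s = (case s of Inl (x, j) \<Rightarrow> if j < e then u s else undefined | Inr _ \<Rightarrow> u s)"
    for u :: "(nat \<times> nat) + (nat \<times> nat) \<Rightarrow> 'm" and s
  define S' where "S' u \<longleftrightarrow> restrict (\<lambda>j. u (Inl (i, j))) {..<e} \<in> range \<iota> \<and> S (trim u)" for u
  define Z :: "((nat \<times> nat) + (nat \<times> nat)) set" where "Z = Inl ` ({i} \<times> UNIV)"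
  have trim_subst: "trim u = (\<lambda>s. case_sum u id
      (case s of Inl (x, j) \<Rightarrow> if j < e then Inl s else Inr undefined | Inr _ \<Rightarrow> Inl s))" for u
    by (auto simp: trim_def fun_eq_iff split: sum.splits)
  have "mdef M (\<lambda>u. restrict (\<lambda>j. u (Inl (i, j))) {..<e} \<in> range \<iota>)"
    using mdef_rename[OF mdef_definable[OF definable_range]] .
  moreover have "mdef M (\<lambda>u. S (trim u))"
    unfolding trim_subst by (rule mdef_subst[OF S(1)])
  ultimately have "mdef M S'"
    unfolding S'_def by (rule mdef_conj)
  then have "mdef M (\<lambda>u. \<exists>u'. S' (\<lambda>s. if s \<in> Z then u' s else u s))"
    by (rule mdef_ex)
  moreover have "(\<exists>a. R (v(i := a)) w) = (\<exists>u'. S' (\<lambda>s. if s \<in> Z then u' s else kenv v w s))" for v w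
  proof
    assume "\<exists>a. R (v(i := a)) w"
    then obtain a where "R (v(i := a)) w" by blast
    moreover have "trim (\<lambda>s. if s \<in> Z then kenv (v(i := a)) w s else kenv v w s) = kenv (v(i := a)) w"
      by (auto simp: fun_eq_iff trim_def kenv_def Z_def emb_undef split: sum.splits)
    moreover have "restrict (\<lambda>j. \<iota> a j) {..<e} = \<iota> a"
      by (auto simp: restrict_def fun_eq_iff emb_undef)
    ultimately have "S' (\<lambda>s. if s \<in> Z then kenv (v(i := a)) w s else kenv v w s)"
      unfolding S'_def S(2) by (auto simp: Z_def kenv_def)
    then show "\<exists>u'. S' (\<lambda>s. if s \<in> Z then u' s else kenv v w s)"
      by (rule exI[of _ "kenv (v(i := a)) w"])
  next
    assume "\<exists>u'. S' (\<lambda>s. if s \<in> Z then u' s else kenv v w s)"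
    then obtain u' where u': "S' (\<lambda>s. if s \<in> Z then u' s else kenv v w s)" by blast
    then obtain a where a: "restrict (\<lambda>j. u' (Inl (i, j))) {..<e} = \<iota> a"
      unfolding S'_def by (auto simp: Z_def)
    have "u' (Inl (i, j)) = \<iota> a j" if "j < e" for j
      using fun_cong[OF a, of j] that by simp
    then have "trim (\<lambda>s. if s \<in> Z then u' s else kenv v w s) = kenv (v(i := a)) w"
      by (auto simp: fun_eq_iff trim_def kenv_def Z_def emb_undef split: sum.splits)
    with u' show "\<exists>a. R (v(i := a)) w"
      unfolding S'_def S(2) by auto
  qed
  ultimately show ?thesis by (rule kdefI)
qed

lemma kdef_ex_finite:
  assumes "finite I" "kdef R"
  shows "kdef (\<lambda>v w. \<exists>v'. R (\<lambda>x. if x \<in> I then v' x else v x) w)"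
  by (rule finite_ex_closed[of I kdef R, OF assms]) (rule kdef_ex)

lemma kdef_ex_tuple:
  assumes "kdef R"
  shows "kdef (\<lambda>v w. \<exists>b. R v (w(i := b)))"
proof -
  obtain S where S: "mdef M S" "\<And>v w. R v w = S (kenv v w)" using kdefE[OF assms] by metis
  define Z :: "((nat \<times> nat) + (nat \<times> nat)) set" where "Z = Inr ` ({i} \<times> UNIV)"
  have "(\<exists>b. R v (w(i := b))) = (\<exists>u'. S (\<lambda>s. if s \<in> Z then u' s else kenv v w s))" for v w
  proof
    assume "\<exists>b. R v (w(i := b))"
    then obtain b where "R v (w(i := b))" by blast
    moreover have "(\<lambda>s. if s \<in> Z then kenv v (w(i := b)) s else kenv v w s) = kenv v (w(i := b))"
      by (auto simp: fun_eq_iff kenv_def Z_def split: sum.splits)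
    ultimately show "\<exists>u'. S (\<lambda>s. if s \<in> Z then u' s else kenv v w s)"
      unfolding S(2) by metis
  next
    assume "\<exists>u'. S (\<lambda>s. if s \<in> Z then u' s else kenv v w s)"
    then obtain u' where "S (\<lambda>s. if s \<in> Z then u' s else kenv v w s)" by blast
    moreover have "(\<lambda>s. if s \<in> Z then u' s else kenv v w s) = kenv v (w(i := \<lambda>j. u' (Inr (i, j))))"
      by (auto simp: fun_eq_iff kenv_def Z_def split: sum.splits)
    ultimately show "\<exists>b. R v (w(i := b))" unfolding S(2) by metis
  qed
  then show ?thesis by (rule kdefI[OF mdef_ex[OF S(1)]])
qed

lemma embed_power_eq_iff:
  assumes "x \<in> tuples n" "y \<in> tuples n"
  shows "embed_power e \<iota> n x = embed_power e \<iota> n y \<longleftrightarrow> x = y"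
proof
  assume eq: "embed_power e \<iota> n x = embed_power e \<iota> n y"
  have "x i = y i" if "i < n" for i
  proof -
    have "\<iota> (x i) j = \<iota> (y i) j" for j
    proof (cases "j < e")
      case True
      with fun_cong[OF eq, of "i * e + j"] block_less[OF that True] show ?thesis
        by (simp add: embed_power_def div_mod_block del: div_mult_self3 mod_mult_self3)
    qed (simp add: emb_undef)
    then have "\<iota> (x i) = \<iota> (y i)" by blast
    then show ?thesis using inj_emb by (simp add: inj_eq)
  qed
  then show "x = y" by (intro PiE_ext[OF assms]) auto
qed simp

lemma kdef_of_definable_in_power:
  assumes "definable_in_power M e \<iota> n A"
  shows "kdef (\<lambda>v w. restrict v {..<n} \<in> A)"
proof (rule kdefI)
  let ?D = "embed_power e \<iota> n ` A"
  show "mdef M (\<lambda>u :: (nat \<times> nat) + (nat \<times> nat) \<Rightarrow> 'm.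
      restrict (\<lambda>j. u (Inl (j div e, j mod e))) {..<n * e} \<in> ?D)"
    using assms by (intro mdef_rename[OF mdef_definable]) (simp add: definable_in_power_def)
  fix v w
  have "j div e < n" if "j < n * e" for j
    using that by (simp add: less_mult_imp_div_less)
  then have "restrict (\<lambda>j. kenv v w (Inl (j div e, j mod e))) {..<n * e} =
      embed_power e \<iota> n (restrict v {..<n})"
    by (auto simp: embed_power_def kenv_def fun_eq_iff)
  moreover have "embed_power e \<iota> n (restrict v {..<n}) \<in> ?D \<longleftrightarrow> restrict v {..<n} \<in> A"
  proof -
    have "A \<subseteq> tuples n" using assms by (simp add: definable_in_power_def)
    moreover have "restrict v {..<n} \<in> tuples n" by auto
    ultimately show ?thesis using embed_power_eq_iff by (auto simp: image_iff subset_iff)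
  qed
  ultimately show "(restrict v {..<n} \<in> A) =
      (restrict (\<lambda>j. kenv v w (Inl (j div e, j mod e))) {..<n * e} \<in> ?D)" by simp
qed

lemma definable_in_power_of_kdef:
  assumes "kdef R"
  shows "definable_in_power M e \<iota> n {x \<in> tuples n. R x w}"
proof -
  obtain S where S: "mdef M S" "\<And>v w. R v w = S (kenv v w)" using kdefE[OF assms] by metis
  \<comment> \<open>A point of \<open>tuples n\<close> has value \<open>undefined\<close> at field
    variables from \<open>n\<close> on, so these read the coordinates of
    \<open>\<iota> undefined\<close>. This default is also right for \<open>x < n\<close> and
    \<open>j \<ge> e\<close>, where every \<open>\<iota> a j\<close> is
    \<open>undefined\<close>.\<close>
  define U where "U u s = (case s of Inl (x, j) \<Rightarrow> if x < n \<and> j < e then u (x * e + j) else \<iota> undefined j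
      | Inr (x, j) \<Rightarrow> w x j)" for u and s :: "(nat \<times> nat) + (nat \<times> nat)"
  define S' where "S' u \<longleftrightarrow> (\<forall>i\<in>{..<n}. restrict (\<lambda>j. u (i * e + j)) {..<e} \<in> range \<iota>) \<and> S (U u)" for u
  have U_subst: "U u = (\<lambda>s. case_sum u id (case s of
      Inl (x, j) \<Rightarrow> if x < n \<and> j < e then Inl (x * e + j) else Inr (\<iota> undefined j)
      | Inr (x, j) \<Rightarrow> Inr (w x j)))" for u
    by (auto simp: U_def fun_eq_iff split: sum.splits)
  have "mdef M (\<lambda>u. S (U u))"
    unfolding U_subst by (rule mdef_subst[OF S(1)])
  then have "mdef M S'"
    unfolding S'_def
    by (intro mdef_conj mdef_ball_finite mdef_rename[OF mdef_definable[OF definable_range]]) auto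
  then have "definable M (n * e) {y \<in> tuples (n * e). S' y}"
    by (rule definable_mdef)
  moreover have "embed_power e \<iota> n ` {x \<in> tuples n. R x w} = {y \<in> tuples (n * e). S' y}"
  proof -
    have coord: "restrict (\<lambda>j. embed_power e \<iota> n x (i * e + j)) {..<e} = \<iota> (x i)" if "i < n" for x i
      using that by (auto simp: fun_eq_iff embed_power_def div_mod_block block_less emb_undef
          simp del: div_mult_self3 mod_mult_self3)
    have U_emb: "U (embed_power e \<iota> n x) = kenv x w" if "x \<in> tuples n" for x
      using that by (auto simp: fun_eq_iff U_def kenv_def embed_power_def div_mod_block block_less
          emb_undef PiE_iff extensional_def simp del: div_mult_self3 mod_mult_self3 split: sum.splits)
    have emb_sat: "embed_power e \<iota> n x \<in> {y \<in> tuples (n * e). S' y}" if "x \<in> tuples n" "R x w" for x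
    proof -
      have "embed_power e \<iota> n x \<in> tuples (n * e)" by (auto simp: embed_power_def)
      then show ?thesis using that U_emb coord by (auto simp: S'_def S(2))
    qed
    have sat_emb: "y \<in> embed_power e \<iota> n ` {x \<in> tuples n. R x w}" if y: "y \<in> tuples (n * e)" "S' y" for y
    proof -
      have "\<exists>a. restrict (\<lambda>j. y (i * e + j)) {..<e} = \<iota> a" if "i < n" for i
        using y(2) that unfolding S'_def by blast
      then obtain x0 where x0: "restrict (\<lambda>j. y (i * e + j)) {..<e} = \<iota> (x0 i)" if "i < n" for i
        by metis
      define x where "x = restrict x0 {..<n}"
      have "y k = embed_power e \<iota> n x k" for k
      proof (cases "k < n * e")
        case True
        then have "0 < e" by (cases e) auto
        with True have "k div e < n" "k mod e < e"
          by (auto simp: less_mult_imp_div_less)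
        then have "\<iota> (x0 (k div e)) (k mod e) = y (k div e * e + k mod e)"
          using fun_cong[OF x0, of "k div e" "k mod e"] by simp
        then show ?thesis using True \<open>k div e < n\<close> by (simp add: embed_power_def x_def)
      next
        case False
        then show ?thesis using y(1) by (auto simp: embed_power_def PiE_iff extensional_def)
      qed
      then have y_eq: "y = embed_power e \<iota> n x" by (rule ext)
      have x: "x \<in> tuples n" by (auto simp: x_def)
      have "S (U y)" using y(2) by (simp add: S'_def)
      then have "R x w" unfolding S(2) y_eq U_emb[OF x] .
      with x y_eq show ?thesis by blast
    qed
    show ?thesis
    proof (intro equalityI image_subsetI subsetI)
      fix x assume "x \<in> {x \<in> tuples n. R x w}"
      then show "embed_power e \<iota> n x \<in> {y \<in> tuples (n * e). S' y}"
        by (intro emb_sat) simp_all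
    next
      fix y assume "y \<in> {y \<in> tuples (n * e). S' y}"
      then show "y \<in> embed_power e \<iota> n ` {x \<in> tuples n. R x w}"
        by (intro sat_emb) simp_all
    qed
  qed
  ultimately show ?thesis by (auto simp: definable_in_power_def)
qed

lemma kdef_add: "kdef (\<lambda>v w. v i + v j = v k)"
proof -
  have "kdef (\<lambda>v w. restrict v {..<3} \<in> {x \<in> tuples 3. x 0 + x 1 = x 2})"
    using df by (intro kdef_of_definable_in_power) (simp add: definable_field_def)
  then have "kdef (\<lambda>v w. v 0 + v 1 = v 2)" by simp
  from kdef_rename[OF this, where f = "\<lambda>x. if x = 0 then i else if x = 1 then j else k"] show ?thesis
    by simp
qed

lemma kdef_mult: "kdef (\<lambda>v w. v i * v j = v k)"
proof -
  have "kdef (\<lambda>v w. restrict v {..<3} \<in> {x \<in> tuples 3. x 0 * x 1 = x 2})"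
    using df by (intro kdef_of_definable_in_power) (simp add: definable_field_def)
  then have "kdef (\<lambda>v w. v 0 * v 1 = v 2)" by simp
  from kdef_rename[OF this, where f = "\<lambda>x. if x = 0 then i else if x = 1 then j else k"] show ?thesis
    by simp
qed

text \<open>This is the graph of addition with second summand 0 and the sum fixed to
  \<open>a\<close>, so no comparison of coordinates is necessary.\<close>

lemma kdef_eq_const: "kdef (\<lambda>v w. v i = a)"
proof -
  have "kdef (\<lambda>v w. v i + v (Suc i) = v (Suc (Suc i)))" by (rule kdef_add)
  from kdef_fix[OF kdef_fix[OF this, of "Suc i" 0], of "Suc (Suc i)" a] show ?thesis by simp
qed

lemma kdef_eq: "kdef (\<lambda>v w. v i = v j)"
proof -
  define l where "l = Suc (max i j)"
  then have "i \<noteq> l" "j \<noteq> l" by auto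
  moreover have "kdef (\<lambda>v w. v i + v l = v j)" by (rule kdef_add)
  note kdef_fix[OF this, of l 0]
  ultimately show ?thesis by simp
qed

end

section \<open>Polynomial functions\<close>

text \<open>Functions of countably many variables are used instead of formal polynomials, because
  the four rules make definability and continuity provable by the same short induction.\<close>

inductive polyfun :: "((nat \<Rightarrow> 'a::comm_ring_1) \<Rightarrow> 'a) \<Rightarrow> bool" where
  const: "polyfun (\<lambda>v. a)"
| var: "polyfun (\<lambda>v. v i)"
| add: "polyfun F \<Longrightarrow> polyfun G \<Longrightarrow> polyfun (\<lambda>v. F v + G v)"
| mult: "polyfun F \<Longrightarrow> polyfun G \<Longrightarrow> polyfun (\<lambda>v. F v * G v)"

lemma polyfun_uminus: "polyfun F \<Longrightarrow> polyfun (\<lambda>v. - F v)"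
  using polyfun.mult[OF polyfun.const[of "-1"]] by simp

lemma polyfun_diff: "polyfun F \<Longrightarrow> polyfun G \<Longrightarrow> polyfun (\<lambda>v. F v - G v)"
  using polyfun.add[OF _ polyfun_uminus] by simp

lemma polyfun_sum: "(\<And>i. i \<in> I \<Longrightarrow> polyfun (F i)) \<Longrightarrow> polyfun (\<lambda>v. \<Sum>i\<in>I. F i v)"
  by (induction I rule: infinite_finite_induct) (auto intro: polyfun.intros)

lemma polyfun_prod: "(\<And>i. i \<in> I \<Longrightarrow> polyfun (F i)) \<Longrightarrow> polyfun (\<lambda>v. \<Prod>i\<in>I. F i v)"
  by (induction I rule: infinite_finite_induct) (auto intro: polyfun.intros)

lemma polyfun_power: "polyfun F \<Longrightarrow> polyfun (\<lambda>v. F v ^ n)"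
  by (induction n) (auto intro: polyfun.intros)

lemmas polyfun_intros = polyfun.intros polyfun_uminus polyfun_diff polyfun_sum polyfun_prod polyfun_power

text \<open>This supplies fresh variables that can hold intermediate values when a polynomial
  function is turned into a formula.\<close>

lemma polyfun_support:
  "polyfun F \<Longrightarrow> \<exists>n. \<forall>v a. \<forall>i\<ge>n. F (v(i := a)) = F v"
proof (induction rule: polyfun.induct)
  case (var i)
  show ?case by (rule exI[of _ "Suc i"]) auto
next
  case (add F G)
  then obtain m n where "\<forall>v a. \<forall>i\<ge>m. F (v(i := a)) = F v" "\<forall>v a. \<forall>i\<ge>n. G (v(i := a)) = G v" by blast
  then show ?case by (intro exI[of _ "max m n"]) (simp del: fun_upd_apply)
next
  case (mult F G)
  then obtain m n where "\<forall>v a. \<forall>i\<ge>m. F (v(i := a)) = F v" "\<forall>v a. \<forall>i\<ge>n. G (v(i := a)) = G v" by blast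
  then show ?case by (intro exI[of _ "max m n"]) (simp del: fun_upd_apply)
qed simp

lemma polyfun_det:
  assumes "\<And>i j. i < n \<Longrightarrow> j < n \<Longrightarrow> polyfun (\<lambda>v. A v $$ (i, j))"
    and "\<And>v. A v \<in> carrier_mat n n"
  shows "polyfun (\<lambda>v. Determinant.det (A v))"
proof -
  have "p i < n" if "p permutes {0..<n}" "i < n" for p i
    using that permutes_in_image[of p "{0..<n}" i] by simp
  then have "polyfun (\<lambda>v. \<Sum>p | p permutes {0..<n}. signof p * (\<Prod>i = 0..<n. A v $$ (i, p i)))"
    by (intro polyfun_intros assms(1)) auto
  then show ?thesis by (simp add: det_def'[OF assms(2)])
qed

lemma polyfun_adj_mat:
  assumes "\<And>i j. i < n \<Longrightarrow> j < n \<Longrightarrow> polyfun (\<lambda>v. A v $$ (i, j))"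
    and A: "\<And>v. A v \<in> carrier_mat n n" and "i < n" "j < n"
  shows "polyfun (\<lambda>v. adj_mat (A v) $$ (i, j))"
proof -
  have dim: "dim_row (A v) = n" "dim_col (A v) = n" for v using A[of v] by auto
  have "polyfun (\<lambda>v. Determinant.det (mat_delete (A v) j i))"
  proof (rule polyfun_det[where n = "n - 1"])
    fix k l assume kl: "k < n - 1" "l < n - 1"
    then show "polyfun (\<lambda>v. mat_delete (A v) j i $$ (k, l))"
      by (auto simp: mat_delete_def dim intro!: assms(1))
  qed (simp add: mat_delete_def dim)
  then show ?thesis
    using assms(3,4) by (simp add: adj_mat_def cofactor_def dim) (intro polyfun_intros)
qed

section \<open>Continuity of polynomial functions and of inversion\<close>

lemma field_topology_topspace: "field_topology \<tau> \<Longrightarrow> topspace \<tau> = UNIV"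
  by (simp add: field_topology_def)

lemma polyfun_continuous:
  assumes \<tau>: "field_topology \<tau>" and t: "\<And>i. continuous_map Z \<tau> (\<lambda>z. t z i)" and "polyfun F"
  shows "continuous_map Z \<tau> (\<lambda>z. F (t z))"
  using assms(3)
proof induction
  case (const a)
  show ?case using \<tau> by (simp add: field_topology_topspace)
next
  case (var i)
  show ?case by (rule t)
next
  case (add F G)
  have "continuous_map Z \<tau> ((\<lambda>(x, y). x + y) \<circ> (\<lambda>z. (F (t z), G (t z))))"
    using add \<tau> by (intro continuous_map_compose[where X' = "prod_topology \<tau> \<tau>"] continuous_map_pairedI)
      (auto simp: field_topology_def)
  then show ?case by (simp add: o_def)
next
  case (mult F G)
  have "continuous_map Z \<tau> ((\<lambda>(x, y). x * y) \<circ> (\<lambda>z. (F (t z), G (t z))))"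
    using mult \<tau> by (intro continuous_map_compose[where X' = "prod_topology \<tau> \<tau>"] continuous_map_pairedI)
      (auto simp: field_topology_def)
  then show ?case by (simp add: o_def)
qed

lemma field_topology_inverse:
  assumes \<tau>: "field_topology \<tau>" and F: "continuous_map Z \<tau> F"
    and nz: "\<And>z. z \<in> topspace Z \<Longrightarrow> F z \<noteq> 0"
  shows "continuous_map Z \<tau> (\<lambda>z. inverse (F z))"
proof -
  have "continuous_map Z \<tau> (inverse \<circ> F)"
    using \<tau> F nz by (intro continuous_map_compose[where X' = "subtopology \<tau> (- {0})"])
      (auto simp: field_topology_def continuous_map_in_subtopology)
  then show ?thesis by (simp add: o_def)
qed

text \<open>Beyond \<open>n\<close> the coordinate is constantly \<open>undefined\<close> on the
  power, so polynomial functions need no bound on their variables in order to be continuous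
  there.\<close>

lemma continuous_coordinate:
  assumes "topspace \<tau> = UNIV"
  shows "continuous_map (power_topology \<tau> n) \<tau> (\<lambda>x. x i)"
proof (cases "i < n")
  case True
  then show ?thesis by (intro continuous_map_product_projection) simp
next
  case False
  have "continuous_map (power_topology \<tau> n) \<tau> (\<lambda>x. undefined)" using assms by simp
  then show ?thesis
    by (rule continuous_map_eq) (use False in \<open>auto simp: PiE_iff extensional_def\<close>)
qed

lemma openin_continuous_preimage:
  "continuous_map Z T F \<Longrightarrow> openin T U \<Longrightarrow> openin Z {z \<in> topspace Z. F z \<in> U}"
  by (simp add: continuous_map_def)

section \<open>Definability of polynomial conditions and of basic open sets\<close>

context embedded_field
begin

text \<open>Only the graphs of addition and multiplication are available, so the values of the two
  subterms are named by quantified field variables \<open>l\<close> and \<open>Suc l\<close>, chosen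
  beyond both supports and different from \<open>i\<close>.\<close>

lemma kdef_polyfun_eq: "polyfun F \<Longrightarrow> kdef (\<lambda>v w. F v = v i)"
proof (induction arbitrary: i rule: polyfun.induct)
  case (const a)
  show ?case using kdef_eq_const[of i a] by (simp add: eq_commute)
next
  case (var j)
  show ?case by (rule kdef_eq)
next
  case (add F G)
  obtain m n where mn: "\<And>v a i. i \<ge> m \<Longrightarrow> F (v(i := a)) = F v" "\<And>v a i. i \<ge> n \<Longrightarrow> G (v(i := a)) = G v"
    using polyfun_support[OF add.hyps(1)] polyfun_support[OF add.hyps(2)] by blast
  define l where "l = Suc (m + n + i)"
  have "kdef (\<lambda>v w. F v = v l \<and> G v = v (Suc l) \<and> v l + v (Suc l) = v i)"
    by (intro kdef_conj add.IH kdef_add)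
  from kdef_ex[OF kdef_ex[OF this, of "Suc l"], of l] show ?case
    using mn by (simp add: l_def)
next
  case (mult F G)
  obtain m n where mn: "\<And>v a i. i \<ge> m \<Longrightarrow> F (v(i := a)) = F v" "\<And>v a i. i \<ge> n \<Longrightarrow> G (v(i := a)) = G v"
    using polyfun_support[OF mult.hyps(1)] polyfun_support[OF mult.hyps(2)] by blast
  define l where "l = Suc (m + n + i)"
  have "kdef (\<lambda>v w. F v = v l \<and> G v = v (Suc l) \<and> v l * v (Suc l) = v i)"
    by (intro kdef_conj mult.IH kdef_mult)
  from kdef_ex[OF kdef_ex[OF this, of "Suc l"], of l] show ?case
    using mn by (simp add: l_def)
qed

lemma kdef_polyfun:
  assumes R: "kdef (\<lambda>v w. R (v 0) w)" and "polyfun F"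
  shows "kdef (\<lambda>v w. R (F v) w)"
proof -
  obtain n where n: "\<And>v a i. i \<ge> n \<Longrightarrow> F (v(i := a)) = F v"
    using polyfun_support[OF assms(2)] by blast
  have "kdef (\<lambda>v w. R (v n) w)"
    using kdef_rename[OF R, of "\<lambda>_. n" id] by (simp only: id_apply)
  then have "kdef (\<lambda>v w. F v = v n \<and> R (v n) w)"
    by (rule kdef_conj[OF kdef_polyfun_eq[OF assms(2)]])
  then have "kdef (\<lambda>v w. \<exists>a. F (v(n := a)) = (v(n := a)) n \<and> R ((v(n := a)) n) w)"
    by (rule kdef_ex)
  moreover have "(\<exists>a. F (v(n := a)) = (v(n := a)) n \<and> R ((v(n := a)) n) w) = R (F v) w" for v w
    unfolding n[OF order.refl] fun_upd_same by blast
  ultimately show ?thesis by (simp only:)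
qed

lemma kdef_polyfun_zero: "polyfun F \<Longrightarrow> kdef (\<lambda>v w. F v = 0)"
  by (rule kdef_polyfun[where R = "\<lambda>a w. a = 0"]) (rule kdef_eq_const)

text \<open>The basis is re-indexed by arbitrary functions: only the first \<open>p\<close> entries
  count, and an index outside \<open>B\<close> yields the empty set. Quantifiers over indices
  therefore need no bound.\<close>

lemma kdef_basic_open:
  assumes "definable_topology M e \<iota> \<tau>"
  obtains nb where "\<And>b. openin \<tau> (nb b)"
    "\<And>U x. openin \<tau> U \<Longrightarrow> x \<in> U \<Longrightarrow> \<exists>b. x \<in> nb b \<and> nb b \<subseteq> U"
    "\<And>j. kdef (\<lambda>v w. v 0 \<in> nb (w j))"
proof -
  from assms obtain p B W where pBW: "definable M p B"
    "definable M (e + p) {tappend e (\<iota> x) b | x b. b \<in> B \<and> x \<in> W b}"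
    "\<forall>b\<in>B. openin \<tau> (W b)"
    "\<forall>U x. openin \<tau> U \<and> x \<in> U \<longrightarrow> (\<exists>b\<in>B. x \<in> W b \<and> W b \<subseteq> U)"
    unfolding definable_topology_def by blast
  define nb where "nb b = (if restrict b {..<p} \<in> B then W (restrict b {..<p}) else {})" for b
  have B: "restrict b {..<p} = b" if "b \<in> B" for b
    using that pBW(1) unfolding definable_def by (auto intro: extensional_restrict simp: PiE_iff)
  show ?thesis
  proof
    show "openin \<tau> (nb b)" for b using pBW(3) by (simp add: nb_def)
    show "\<exists>b. x \<in> nb b \<and> nb b \<subseteq> U" if Ux: "openin \<tau> U" "x \<in> U" for U x
    proof -
      obtain b where b: "b \<in> B" "x \<in> W b" "W b \<subseteq> U" using pBW(4) Ux by blast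
      then have "nb b = W b" by (simp add: nb_def B)
      with b show ?thesis by blast
    qed
    fix j
    let ?D = "{tappend e (\<iota> x) b | x b. b \<in> B \<and> x \<in> W b}"
    show "kdef (\<lambda>v w. v 0 \<in> nb (w j))"
    proof (rule kdefI)
      show "mdef M (\<lambda>u :: (nat \<times> nat) + (nat \<times> nat) \<Rightarrow> 'm.
          restrict (\<lambda>k. u (if k < e then Inl (0, k) else Inr (j, k - e))) {..<e + p} \<in> ?D)"
        by (rule mdef_rename[OF mdef_definable[OF pBW(2)]])
      fix v w
      have "restrict (\<lambda>k. kenv v w (if k < e then Inl (0, k) else Inr (j, k - e))) {..<e + p} =
          tappend e (\<iota> (v 0)) (restrict (w j) {..<p})"
        by (auto simp: fun_eq_iff tappend_def kenv_def restrict_def)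
      moreover have "tappend e (\<iota> x) b \<in> ?D \<longleftrightarrow> b \<in> B \<and> x \<in> W b" for x b
      proof -
        have "x = x' \<and> b = b'" if eq: "tappend e (\<iota> x) b = tappend e (\<iota> x') b'" for x' b'
        proof
          have "\<iota> x i = \<iota> x' i" for i
            using fun_cong[OF eq, of i] by (cases "i < e") (auto simp: tappend_def emb_undef)
          then have "\<iota> x = \<iota> x'" by blast
          then show "x = x'" using inj_emb by (auto dest: injD)
          have "b i = b' i" for i
            using fun_cong[OF eq, of "e + i"] by (simp add: tappend_def)
          then show "b = b'" by blast
        qed
        then show ?thesis by blast
      qed
      ultimately show "(v 0 \<in> nb (w j)) =
          (restrict (\<lambda>k. kenv v w (if k < e then Inl (0, k) else Inr (j, k - e))) {..<e + p} \<in> ?D)"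
        by (simp add: nb_def)
    qed
  qed
qed

end

section \<open>Monic polynomials and their coefficients\<close>

text \<open>Entries from \<open>d\<close> on are ignored, so a whole assignment \<open>v\<close> can
  be passed as a coefficient vector although its later places hold other variables.\<close>

definition poly_of :: "nat \<Rightarrow> (nat \<Rightarrow> 'a::comm_ring_1) \<Rightarrow> 'a poly" where
  "poly_of d g = (\<Sum>i<d. Polynomial.monom (g i) i)"

definition monic_of :: "nat \<Rightarrow> (nat \<Rightarrow> 'a::comm_ring_1) \<Rightarrow> 'a poly" where
  "monic_of d p = Polynomial.monom 1 d + poly_of d p"

lemma coeff_poly_of: "Polynomial.coeff (poly_of d g) i = (if i < d then g i else 0)"
  by (simp add: poly_of_def coeff_sum)

lemma coeff_monic_of:
  "Polynomial.coeff (monic_of d p) i = (if i < d then p i else if i = d then 1 else 0)"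
  by (simp add: monic_of_def coeff_poly_of)

lemma degree_monic_of: "Polynomial.degree (monic_of d p) = d"
  by (rule antisym) (auto intro!: degree_le le_degree simp: coeff_monic_of)

lemma monic_of_in: "monic_of d (p :: nat \<Rightarrow> 'a::field) \<in> monic_polys d"
  by (simp add: monic_polys_def degree_monic_of coeff_monic_of)

lemma monic_of_ne_0: "monic_of d p \<noteq> 0"
  using coeff_monic_of[of d p d] by auto

lemma degree_poly_of: "0 < d \<Longrightarrow> Polynomial.degree (poly_of d g) < d"
proof -
  assume "0 < d"
  moreover have "Polynomial.degree (poly_of d g) \<le> d - 1"
    by (rule degree_le) (auto simp: coeff_poly_of)
  ultimately show ?thesis by linarith
qed

lemma poly_of_coeff:
  "Polynomial.degree p < d \<Longrightarrow> poly_of d (Polynomial.coeff p) = p"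
  by (rule poly_eqI) (auto simp: coeff_poly_of coeff_eq_0)

lemma monic_of_coeff:
  "P \<in> monic_polys d \<Longrightarrow> monic_of d (Polynomial.coeff P) = P"
  by (rule poly_eqI) (auto simp: coeff_monic_of monic_polys_def coeff_eq_0)

lemma poly_of_cong: "(\<And>i. i < d \<Longrightarrow> f i = g i) \<Longrightarrow> poly_of d f = poly_of d g"
  by (simp add: poly_of_def)

lemma monic_of_cong: "(\<And>i. i < d \<Longrightarrow> f i = g i) \<Longrightarrow> monic_of d f = monic_of d g"
  by (simp add: monic_of_def cong: poly_of_cong)

lemma poly_poly_of: "poly (poly_of d g) x = (\<Sum>i<d. g i * x ^ i)"
  by (simp add: poly_of_def poly_sum poly_monom)

lemma poly_monic_of: "poly (monic_of d p) x = x ^ d + (\<Sum>i<d. p i * x ^ i)"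
  by (simp add: monic_of_def poly_monom poly_poly_of)

lemma pcompose_monom: "pcompose (Polynomial.monom c n) G = Polynomial.smult c (G ^ n)"
  by (induction n) (simp_all add: monom_0 monom_Suc pcompose_pCons)

lemma pcompose_poly_of:
  "pcompose (poly_of d c) G = (\<Sum>i<d. Polynomial.smult (c i) (G ^ i))"
  by (simp add: poly_of_def pcompose_sum pcompose_monom)

lemma pcompose_monic_of:
  "pcompose (monic_of d c) G = G ^ d + (\<Sum>i<d. Polynomial.smult (c i) (G ^ i))"
  by (simp add: monic_of_def pcompose_add pcompose_monom pcompose_poly_of)

lemma mod_sum_poly: "(\<Sum>i\<in>I. f i) mod P = (\<Sum>i\<in>I. f i mod P)" for P :: "'a::field poly"
  by (induction I rule: infinite_finite_induct) (simp_all add: poly_mod_add_left)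

lemma dvd_pcompose_diff:
  fixes f A B P :: "'a::field poly"
  assumes "P dvd A - B"
  shows "P dvd pcompose f A - pcompose f B"
proof (induction f)
  case (pCons a f)
  have "pcompose (pCons a f) A - pcompose (pCons a f) B =
      (A - B) * pcompose f A + B * (pcompose f A - pcompose f B)"
    by (simp add: pcompose_pCons algebra_simps)
  then show ?case using assms pCons.IH by (metis dvd_add dvd_mult dvd_mult2)
qed simp

section \<open>Changing the generator of the algebra defined by a polynomial\<close>

text \<open>For \<open>P\<close> of degree \<open>d\<close>, this expresses 1, G, ..., G^(d-1) in
  the basis of powers of x of K[x]/(P). It is invertible exactly when \<open>G\<close> generates
  that algebra.\<close>

definition power_matrix :: "nat \<Rightarrow> 'a::field poly \<Rightarrow> 'a poly \<Rightarrow> 'a mat" where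
  "power_matrix d P G = mat d d (\<lambda>(j, i). Polynomial.coeff (G ^ i mod P) j)"

definition power_det :: "nat \<Rightarrow> 'a::field poly \<Rightarrow> 'a poly \<Rightarrow> 'a" where
  "power_det d P G = Determinant.det (power_matrix d P G)"

text \<open>Cramer's rule: \<open>power_det d P G\<close> times the coordinates of \<open>r mod P\<close> with respect to the
  powers of \<open>G\<close>.\<close>

definition power_coord :: "nat \<Rightarrow> 'a::field poly \<Rightarrow> 'a poly \<Rightarrow> 'a poly \<Rightarrow> nat \<Rightarrow> 'a" where
  "power_coord d P G r i =
     (\<Sum>j<d. adj_mat (power_matrix d P G) $$ (i, j) * Polynomial.coeff (r mod P) j)"

lemma power_matrix_carrier: "power_matrix d P G \<in> carrier_mat d d"
  by (simp add: power_matrix_def)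

lemma power_matrix_adj:
  assumes "i < d" "k < d"
  shows "(\<Sum>j<d. power_matrix d P G $$ (i, j) * adj_mat (power_matrix d P G) $$ (j, k)) =
      (if i = k then power_det d P G else 0)"
    and "(\<Sum>j<d. adj_mat (power_matrix d P G) $$ (i, j) * power_matrix d P G $$ (j, k)) =
      (if i = k then power_det d P G else 0)"
proof -
  let ?B = "power_matrix d P G"
  have B: "?B \<in> carrier_mat d d" "adj_mat ?B \<in> carrier_mat d d"
    using power_matrix_carrier adj_mat(1) by blast+
  have "(?B * adj_mat ?B) $$ (i, k) = (if i = k then power_det d P G else 0)"
    "(adj_mat ?B * ?B) $$ (i, k) = (if i = k then power_det d P G else 0)"
    using assms adj_mat(2,3)[OF B(1)] by (auto simp: power_det_def)
  then show "(\<Sum>j<d. ?B $$ (i, j) * adj_mat ?B $$ (j, k)) = (if i = k then power_det d P G else 0)"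
    "(\<Sum>j<d. adj_mat ?B $$ (i, j) * ?B $$ (j, k)) = (if i = k then power_det d P G else 0)"
    using assms B by (auto simp: times_mat_def scalar_prod_def atLeast0LessThan)
qed

context
  fixes d :: nat and P :: "'a::field poly"
  assumes deg: "Polynomial.degree P = d" and d: "0 < d"
begin

lemma coeff_mod_large: "d \<le> j \<Longrightarrow> Polynomial.coeff (r mod P) j = 0"
  using degree_mod_less[of P r] deg d by (metis coeff_0 coeff_eq_0 degree_0 less_le_trans less_not_refl)

lemma coeff_combination:
  assumes "j < d"
  shows "Polynomial.coeff ((\<Sum>i<d. Polynomial.smult (c i) (G ^ i)) mod P) j =
    (\<Sum>i<d. power_matrix d P G $$ (j, i) * c i)"
  using assms by (simp add: mod_sum_poly coeff_sum mod_smult_left power_matrix_def mult.commute)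

text \<open>The matrix times its adjugate is the determinant times the identity. Leaving the
  determinant as a factor keeps the identity free of division and valid for every
  \<open>G\<close>.\<close>

lemma power_coord_correct:
  "(\<Sum>i<d. Polynomial.smult (power_coord d P G r i) (G ^ i)) mod P =
     Polynomial.smult (power_det d P G) (r mod P)"
proof (rule poly_eqI)
  fix j
  let ?B = "power_matrix d P G"
  show "Polynomial.coeff ((\<Sum>i<d. Polynomial.smult (power_coord d P G r i) (G ^ i)) mod P) j =
    Polynomial.coeff (Polynomial.smult (power_det d P G) (r mod P)) j"
  proof (cases "j < d")
    case True
    have "(\<Sum>i<d. ?B $$ (j, i) * power_coord d P G r i) =
        (\<Sum>i<d. \<Sum>k<d. ?B $$ (j, i) * adj_mat ?B $$ (i, k) * Polynomial.coeff (r mod P) k)"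
      by (simp add: power_coord_def sum_distrib_left mult.assoc)
    also have "\<dots> = (\<Sum>k<d. (\<Sum>i<d. ?B $$ (j, i) * adj_mat ?B $$ (i, k)) * Polynomial.coeff (r mod P) k)"
      by (subst sum.swap) (simp add: sum_distrib_right)
    also have "\<dots> = (\<Sum>k<d. if j = k then power_det d P G * Polynomial.coeff (r mod P) k else 0)"
      using True by (intro sum.cong) (simp_all add: power_matrix_adj(1))
    also have "\<dots> = power_det d P G * Polynomial.coeff (r mod P) j"
      using True by simp
    finally show ?thesis using True by (simp add: coeff_combination)
  qed (simp add: coeff_mod_large)
qed

lemma powers_independent:
  assumes "power_det d P G \<noteq> 0" "P dvd (\<Sum>i<d. Polynomial.smult (c i) (G ^ i))" "i < d"
  shows "c i = 0"
proof -
  let ?B = "power_matrix d P G"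
  have 0: "(\<Sum>k<d. ?B $$ (j, k) * c k) = 0" if "j < d" for j
    using coeff_combination[OF that, of c G] assms(2) by (simp add: mod_eq_0_iff_dvd)
  have "power_det d P G * c i = (\<Sum>k<d. (\<Sum>j<d. adj_mat ?B $$ (i, j) * ?B $$ (j, k)) * c k)"
    using assms(3) by (simp add: power_matrix_adj(2) if_distrib[of "\<lambda>x. x * _"] cong: if_cong)
  also have "\<dots> = (\<Sum>j<d. adj_mat ?B $$ (i, j) * (\<Sum>k<d. ?B $$ (j, k) * c k))"
    by (simp only: sum_distrib_left sum_distrib_right mult.assoc) (rule sum.swap)
  also have "\<dots> = 0" by (simp add: 0)
  finally show ?thesis using assms(1) by simp
qed

text \<open>If \<open>G\<close> is a generator, these are the lower coefficients of the only monic
  relation of degree \<open>d\<close> that \<open>G\<close> satisfies modulo \<open>P\<close>,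
  namely the characteristic polynomial of multiplication by \<open>G\<close>.\<close>

definition char_coord :: "'a poly \<Rightarrow> nat \<Rightarrow> 'a" where
  "char_coord G i = - power_coord d P G (G ^ d) i / power_det d P G"

text \<open>For a generator \<open>G\<close>, these are the coefficients of the polynomial h of
  degree below \<open>d\<close> with h(G) = x modulo \<open>P\<close>.\<close>

definition inv_coord :: "'a poly \<Rightarrow> nat \<Rightarrow> 'a" where
  "inv_coord G i = power_coord d P G [:0, 1:] i / power_det d P G"

lemma char_coord_dvd:
  assumes "power_det d P G \<noteq> 0"
  shows "P dvd pcompose (monic_of d (char_coord G)) G"
proof -
  have "(\<Sum>i<d. Polynomial.smult (char_coord G i) (G ^ i)) =
    Polynomial.smult (- inverse (power_det d P G)) (\<Sum>i<d. Polynomial.smult (power_coord d P G (G ^ d) i) (G ^ i))"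
    unfolding smult_sum2 by (intro sum.cong) (auto simp: char_coord_def field_simps)
  then have "(\<Sum>i<d. Polynomial.smult (char_coord G i) (G ^ i)) mod P = - (G ^ d mod P)"
    using assms by (simp add: mod_smult_left power_coord_correct del: smult_minus_left) simp
  then show ?thesis
    by (simp add: pcompose_monic_of poly_mod_add_left flip: mod_eq_0_iff_dvd)
qed

lemma inv_coord_dvd:
  assumes "power_det d P G \<noteq> 0"
  shows "P dvd pcompose (poly_of d (inv_coord G)) G - [:0, 1:]"
proof -
  have "(\<Sum>i<d. Polynomial.smult (inv_coord G i) (G ^ i)) =
    Polynomial.smult (inverse (power_det d P G)) (\<Sum>i<d. Polynomial.smult (power_coord d P G [:0, 1:] i) (G ^ i))"
    unfolding smult_sum2 by (intro sum.cong) (auto simp: inv_coord_def field_simps)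
  then have "(\<Sum>i<d. Polynomial.smult (inv_coord G i) (G ^ i)) mod P = [:0, 1:] mod P"
    using assms by (simp add: mod_smult_left power_coord_correct)
  then show ?thesis
    by (simp add: pcompose_poly_of mod_eq_dvd_iff)
qed

lemma char_root:
  assumes "power_det d P G \<noteq> 0" "poly P a = 0"
  shows "poly (monic_of d (char_coord G)) (poly G a) = 0"
  using char_coord_dvd[OF assms(1)] assms(2) by (auto simp: dvd_def simp flip: poly_pcompose)

lemma inv_root:
  assumes "power_det d P G \<noteq> 0" "poly P a = 0"
  shows "poly (poly_of d (inv_coord G)) (poly G a) = a"
proof -
  have "poly (pcompose (poly_of d (inv_coord G)) G - [:0, 1:]) a = 0"
    using inv_coord_dvd[OF assms(1)] assms(2) by (metis dvd_def mult_eq_0_iff poly_mult)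
  then show ?thesis by (simp add: poly_pcompose)
qed

text \<open>The point is that \<open>G\<close> generates the algebra of polynomials modulo \<open>P\<close>.\<close>

lemma root_of_char_root:
  assumes D: "power_det d P G \<noteq> 0" and y: "poly (monic_of d (char_coord G)) y = 0"
  shows "poly P (poly (poly_of d (inv_coord G)) y) = 0"
proof -
  define C where "C = monic_of d (char_coord G)"
  define H where "H = poly_of d (inv_coord G)"
  \<comment> \<open>Modulo \<open>P\<close>, substituting \<open>G\<close> sends \<open>C\<close> to
    0 and \<open>pcompose P H\<close> to P(x), which is 0. So \<open>r\<close> vanishes at
    \<open>G\<close>, and having degree below \<open>d\<close> it is 0 by independence of the
    powers. Thus \<open>C\<close> divides \<open>pcompose P H\<close>.\<close>
  define r where "r = pcompose P H mod C"
  have "C \<noteq> 0" "Polynomial.degree C = d" by (simp_all add: C_def monic_of_ne_0 degree_monic_of)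
  then have "Polynomial.degree r < d"
    using degree_mod_less[of C "pcompose P H"] d by (auto simp: r_def)
  then have r: "r = poly_of d (Polynomial.coeff r)" by (simp add: poly_of_coeff)
  have "C dvd pcompose P H - r" by (simp add: r_def dvd_minus_mod)
  then have "pcompose C G dvd pcompose (pcompose P H - r) G"
    by (metis dvd_def pcompose_mult)
  then have "P dvd pcompose P (pcompose H G) - pcompose r G"
    using char_coord_dvd[OF D] dvd_trans by (simp add: C_def pcompose_diff pcompose_assoc)
  moreover have "P dvd pcompose P (pcompose H G)"
  proof -
    have "P dvd pcompose P (pcompose H G) - pcompose P [:0, 1:]"
      using inv_coord_dvd[OF D] by (intro dvd_pcompose_diff) (simp add: H_def)
    then show ?thesis using dvd_diff_right_iff[of P] by (simp add: dvd_diff_left_iff)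
  qed
  ultimately have "P dvd pcompose r G" by (metis dvd_diff_right_iff)
  then have "P dvd (\<Sum>i<d. Polynomial.smult (Polynomial.coeff r i) (G ^ i))"
    by (subst (asm) r) (simp add: pcompose_poly_of)
  then have "Polynomial.coeff r i = 0" if "i < d" for i
    using powers_independent[OF D] that by blast
  then have "r = 0" by (subst r) (simp add: poly_of_def)
  then have "C dvd pcompose P H" by (simp add: r_def mod_eq_0_iff_dvd)
  then have "poly (pcompose P H) y = 0"
    using y unfolding C_def by (metis dvd_def mult_eq_0_iff poly_mult)
  then show ?thesis by (simp add: poly_pcompose H_def)
qed

text \<open>The class of x is a generator, which shows that the open set of generators is not empty.
  Reduction modulo \<open>P\<close> has an effect only for \<open>d = 1\<close>, where x is not
  itself a remainder.\<close>

lemma power_det_generator: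
  "power_det d P ([:0, 1:] mod P) = 1"
proof -
  have "([:0, 1:] mod P) ^ i mod P = Polynomial.monom 1 i" if "i < d" for i
  proof -
    have "([:0, 1:] mod P) ^ i mod P = Polynomial.monom 1 i mod P"
      by (simp add: power_mod monom_altdef)
    then show ?thesis using that deg by (simp add: mod_poly_less degree_monom_eq)
  qed
  then have "power_matrix d P ([:0, 1:] mod P) = 1\<^sub>m d"
    by (intro eq_matI) (auto simp: power_matrix_def)
  then show ?thesis by (simp add: power_det_def)
qed

end

section \<open>Finitely many generators share a characteristic polynomial\<close>

lemma card_roots_separable:
  fixes Q :: "'a::alg_closed_field poly"
  assumes "rsquarefree Q"
  shows "card {x. poly Q x = 0} = Polynomial.degree Q"
proof -
  have Q: "Q \<noteq> 0" "\<And>x. Polynomial.order x Q \<le> 1"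
    using assms unfolding rsquarefree_def by (auto simp: le_Suc_eq)
  obtain A where A: "size A = Polynomial.degree Q"
    "Q = Polynomial.smult (Polynomial.lead_coeff Q) (\<Prod>x\<in>#A. [:-x, 1:])"
    using alg_closed_imp_factorization[OF Q(1)] by blast
  have "proots Q = proots (\<Prod>x\<in>#A. [:-x, 1:])"
    using Q(1) by (subst A(2)) simp
  also have "\<dots> = A"
  proof (induction A)
    case (add x A)
    have "(\<Prod>x\<in>#A. [:-x, 1:]) \<noteq> 0" by (auto simp: prod_mset_zero_iff)
    then show ?case using add by (simp add: proots_mult del: mult_pCons_left)
  qed simp
  finally have "proots Q = A" .
  have "Polynomial.degree Q = (\<Sum>x\<in>set_mset A. count A x)"
    using A(1) by (simp add: size_multiset_overloaded_eq)
  also have "\<dots> = (\<Sum>x\<in>set_mset A. 1)"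
  proof (rule sum.cong)
    fix x assume "x \<in># A"
    then have "1 \<le> count A x" by (simp add: Suc_le_eq)
    moreover have "count A x \<le> 1" using Q \<open>proots Q = A\<close> by (metis count_proots)
    ultimately show "count A x = 1" by (rule antisym[rotated])
  qed simp
  also have "set_mset A = {x. poly Q x = 0}"
    using Q(1) \<open>proots Q = A\<close> by (metis set_count_proots)
  finally show ?thesis by simp
qed

text \<open>The value of \<open>g\<close> at each of the \<open>d\<close> distinct roots of \<open>Q\<close> is a root of the characteristic
  relation.\<close>

lemma finite_generators_with_char:
  fixes Q C :: "'a::field poly"
  assumes sep: "separable_poly Q" and "C \<noteq> 0" "0 < Polynomial.degree Q"
  shows "finite {G. Polynomial.degree G < Polynomial.degree Q \<and> Q dvd pcompose C G}"
proof -
  interpret ac: inj_idom_hom "to_ac :: 'a \<Rightarrow> 'a alg_closure"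
    by unfold_locales simp_all
  interpret acp: map_poly_inj_idom_hom "to_ac :: 'a \<Rightarrow> 'a alg_closure" ..
  let ?f = "map_poly to_ac :: 'a poly \<Rightarrow> 'a alg_closure poly"
  define R where "R = {x. poly (?f Q) x = 0}"
  define R' where "R' = {x. poly (?f C) x = 0}"
  have "?f C \<noteq> 0" using assms(2) by simp
  then have "finite R'" unfolding R'_def by (rule poly_roots_finite)
  have cardR: "card R = Polynomial.degree Q"
    using card_roots_separable[of "?f Q"] sep by (simp add: R_def separable_poly_def)
  then have "finite R" using assms(3) card_ge_0_finite by force
  let ?S = "{G. Polynomial.degree G < Polynomial.degree Q \<and> Q dvd pcompose C G}"
  let ?ev = "\<lambda>G. restrict (poly (?f G)) R"
  have "?ev ` ?S \<subseteq> R \<rightarrow>\<^sub>E R'"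
  proof (clarsimp simp: R_def R'_def)
    fix G x assume "Q dvd pcompose C G" "poly (?f Q) x = 0"
    then have "poly (?f (pcompose C G)) x = 0"
      by (auto simp: dvd_def acp.hom_mult)
    then show "poly (?f C) (poly (?f G) x) = 0"
      by (simp add: ac.map_poly_pcompose poly_pcompose)
  qed
  then have "finite (?ev ` ?S)"
    using finite_PiE[OF \<open>finite R\<close>] \<open>finite R'\<close> by (meson finite_subset)
  \<comment> \<open>Two polynomials of degree below d that agree at d distinct points coincide;
    separability provides that many points.\<close>
  moreover have "inj_on ?ev ?S"
  proof (rule inj_onI)
    fix G H assume GH: "G \<in> ?S" "H \<in> ?S" "?ev G = ?ev H"
    have "poly (?f G) x = poly (?f H) x" if "x \<in> R" for x
      using fun_cong[OF GH(3), of x] that by simp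
    then have "?f G = ?f H"
      using GH cardR by (intro poly_eqI_degree[of R]) auto
    then show "G = H" by simp
  qed
  ultimately show ?thesis by (rule finite_imageD)
qed

section \<open>Polynomial dependence of remainders, determinants and Cramer coordinates\<close>

lemma polyfun_if:
  "(c \<Longrightarrow> polyfun F) \<Longrightarrow> (\<not> c \<Longrightarrow> polyfun G) \<Longrightarrow> polyfun (\<lambda>v. if c then F v else G v)"
  by (cases c) simp_all

definition polyfun_coeffs :: "((nat \<Rightarrow> 'a::comm_ring_1) \<Rightarrow> 'a poly) \<Rightarrow> bool" where
  "polyfun_coeffs F \<longleftrightarrow> (\<forall>j. polyfun (\<lambda>v. Polynomial.coeff (F v) j))"

lemma polyfun_coeffs_const: "polyfun_coeffs (\<lambda>v. c)"
  by (simp add: polyfun_coeffs_def polyfun.const)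

lemma polyfun_coeffs_mult:
  "polyfun_coeffs F \<Longrightarrow> polyfun_coeffs G \<Longrightarrow> polyfun_coeffs (\<lambda>v. F v * G v)"
  unfolding polyfun_coeffs_def coeff_mult by (intro allI polyfun_intros) auto

lemma polyfun_coeffs_power: "polyfun_coeffs F \<Longrightarrow> polyfun_coeffs (\<lambda>v. F v ^ n)"
  by (induction n) (auto intro: polyfun_coeffs_const polyfun_coeffs_mult)

lemma polyfun_coeffs_poly_of:
  "(\<And>i. polyfun (\<lambda>v. g v i)) \<Longrightarrow> polyfun_coeffs (\<lambda>v. poly_of d (g v))"
  unfolding polyfun_coeffs_def coeff_poly_of by (intro allI polyfun_if polyfun.const) simp

lemma polyfun_coeffs_monic_of:
  "(\<And>i. polyfun (\<lambda>v. p v i)) \<Longrightarrow> polyfun_coeffs (\<lambda>v. monic_of d (p v))"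
  unfolding polyfun_coeffs_def coeff_monic_of by (intro allI polyfun_if polyfun.const) simp

lemma polyfun_poly:
  assumes "\<And>i. polyfun (\<lambda>v. p v i)" "polyfun x"
  shows "polyfun (\<lambda>v. poly (monic_of d (p v)) (x v))"
  unfolding poly_monic_of using assms by (intro polyfun_intros) auto

text \<open>Division by a monic polynomial eliminates the leading terms one after the other.\<close>

lemma polyfun_coeffs_mod:
  fixes P :: "(nat \<Rightarrow> 'a::field) \<Rightarrow> 'a poly"
  assumes P: "polyfun_coeffs P" "\<And>v. P v \<in> monic_polys d" and d: "0 < d"
  shows "polyfun_coeffs F \<Longrightarrow> (\<And>v. Polynomial.degree (F v) \<le> n) \<Longrightarrow> polyfun_coeffs (\<lambda>v. F v mod P v)"
proof (induction n arbitrary: F)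
  case 0
  then have "F v mod P v = F v" for v
    using P(2)[of v] d by (intro mod_poly_less) (simp add: monic_polys_def)
  with 0 show ?case by simp
next
  case (Suc n)
  show ?case
  proof (cases "Suc n < d")
    case True
    then have "F v mod P v = F v" for v
      using P(2)[of v] Suc.prems(2)[of v] by (intro mod_poly_less) (simp add: monic_polys_def)
    with Suc.prems show ?thesis by simp
  next
    case False
    \<comment> \<open>The bound \<open>n\<close> is uniform in \<open>v\<close> and the coefficient
      in degree \<open>Suc n\<close> may vanish for some \<open>v\<close>. The same subtraction is
      made in all cases, so no case distinction on the true degree spoils polynomiality.\<close>
    define H where "H v = Polynomial.monom 1 (Suc n - d) * P v" for v
    define F' where "F' v = F v - Polynomial.smult (Polynomial.coeff (F v) (Suc n)) (H v)" for v
    have H: "polyfun_coeffs H"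
      unfolding H_def using P by (intro polyfun_coeffs_mult polyfun_coeffs_const)
    have "Polynomial.coeff (H v) (Suc n) = 1" for v
      using P(2)[of v] False by (auto simp: H_def coeff_monom_mult monic_polys_def)
    moreover have "Polynomial.degree (H v) \<le> Suc n" for v
      using degree_mult_le[of "Polynomial.monom 1 (Suc n - d)" "P v"] P(2)[of v] False
      by (simp add: H_def monic_polys_def degree_monom_eq)
    ultimately have degree_F': "Polynomial.degree (F' v) \<le> n" for v
    proof (intro degree_le allI impI)
      fix i assume "n < i"
      then consider "i = Suc n" | "Suc n < i" by linarith
      then show "Polynomial.coeff (F' v) i = 0"
      proof cases
        case 1
        with \<open>Polynomial.coeff (H v) (Suc n) = 1\<close> show ?thesis by (simp add: F'_def)
      next
        case 2
        then have "Polynomial.degree (F v) < i" "Polynomial.degree (H v) < i"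
          using Suc.prems(2)[of v] \<open>Polynomial.degree (H v) \<le> Suc n\<close> by linarith+
        then show ?thesis by (simp add: F'_def coeff_eq_0)
      qed
    qed
    have "polyfun_coeffs F'"
      using H Suc.prems(1) unfolding F'_def polyfun_coeffs_def by (auto intro!: polyfun_diff polyfun.mult)
    then have "polyfun_coeffs (\<lambda>v. F' v mod P v)" by (rule Suc.IH[OF _ degree_F'])
    moreover have "F' v mod P v = F v mod P v" for v
      by (simp add: F'_def H_def mod_eq_dvd_iff dvd_smult)
    ultimately show ?thesis by simp
  qed
qed

context
  fixes p g :: "(nat \<Rightarrow> 'a::field) \<Rightarrow> nat \<Rightarrow> 'a" and d :: nat
  assumes p: "\<And>i. polyfun (\<lambda>v. p v i)" and g: "\<And>i. polyfun (\<lambda>v. g v i)" and d: "0 < d"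
begin

lemma polyfun_coeffs_mod_monic_of:
  assumes "polyfun_coeffs F" "\<And>v. Polynomial.degree (F v) \<le> n"
  shows "polyfun (\<lambda>v. Polynomial.coeff (F v mod monic_of d (p v)) j)"
  using polyfun_coeffs_mod[OF polyfun_coeffs_monic_of[OF p] monic_of_in d assms]
  by (simp add: polyfun_coeffs_def)

lemma degree_power_poly_of: "Polynomial.degree (poly_of d (g v) ^ i) \<le> d * i"
  using degree_power_le[of "poly_of d (g v)" i] degree_poly_of[OF d, of "g v"]
  by (meson le_trans less_imp_le mult_le_mono1)

lemma polyfun_power_matrix:
  "i < d \<Longrightarrow> j < d \<Longrightarrow>
     polyfun (\<lambda>v. power_matrix d (monic_of d (p v)) (poly_of d (g v)) $$ (i, j))"
  by (simp add: power_matrix_def)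
     (intro polyfun_coeffs_mod_monic_of[OF polyfun_coeffs_power[OF polyfun_coeffs_poly_of[OF g]] degree_power_poly_of])

lemma polyfun_power_det: "polyfun (\<lambda>v. power_det d (monic_of d (p v)) (poly_of d (g v)))"
  unfolding power_det_def by (rule polyfun_det[OF polyfun_power_matrix power_matrix_carrier])

lemma polyfun_power_coord:
  assumes "polyfun_coeffs r" "\<And>v. Polynomial.degree (r v) \<le> n" "i < d"
  shows "polyfun (\<lambda>v. power_coord d (monic_of d (p v)) (poly_of d (g v)) (r v) i)"
  unfolding power_coord_def using assms
  by (intro polyfun_sum polyfun.mult polyfun_adj_mat[OF polyfun_power_matrix power_matrix_carrier]
      polyfun_coeffs_mod_monic_of) auto

lemma polyfun_power_coord_char:
  "i < d \<Longrightarrow> polyfun (\<lambda>v. power_coord d (monic_of d (p v)) (poly_of d (g v)) (poly_of d (g v) ^ d) i)"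
  by (rule polyfun_power_coord[OF polyfun_coeffs_power[OF polyfun_coeffs_poly_of[OF g]] degree_power_poly_of])

lemma polyfun_power_coord_inv:
  "i < d \<Longrightarrow> polyfun (\<lambda>v. power_coord d (monic_of d (p v)) (poly_of d (g v)) [:0, 1:] i)"
  by (rule polyfun_power_coord[OF polyfun_coeffs_const, of _ 1]) simp_all

end

context embedded_field
begin

lemma kdef_all: "kdef R \<Longrightarrow> kdef (\<lambda>v w. \<forall>a. R (v(i := a)) w)"
  using kdef_not[OF kdef_ex[OF kdef_not]] by simp

lemma kdef_all_tuple: "kdef R \<Longrightarrow> kdef (\<lambda>v w. \<forall>b. R v (w(i := b)))"
  using kdef_not[OF kdef_ex_tuple[OF kdef_not]] by simp

end

section \<open>Stable roots\<close>

definition stable_root :: "'k::field topology \<Rightarrow> nat \<Rightarrow> (nat \<Rightarrow> 'k) \<Rightarrow> 'k \<Rightarrow> bool" where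
  "stable_root \<tau> d p x \<longleftrightarrow>
     (\<forall>U. openin \<tau> U \<and> x \<in> U \<longrightarrow> (\<exists>V. openin (power_topology \<tau> d) V \<and> p \<in> V \<and>
        (\<forall>p'\<in>V. \<exists>y\<in>U. poly (monic_of d p') y = 0)))"

definition unstable :: "'k::field topology \<Rightarrow> nat \<Rightarrow> (nat \<Rightarrow> 'k) set" where
  "unstable \<tau> d = {p \<in> tuples d. \<exists>x. poly (monic_of d p) x = 0 \<and> \<not> stable_root \<tau> d p x}"

lemma poly_monic_of_restrict: "poly (monic_of d (restrict p {..<d})) x = poly (monic_of d p) x"
  by (simp add: poly_monic_of)

lemma finite_roots: "finite {x. poly (monic_of d p) (x :: 'k::field) = 0}"
  by (rule poly_roots_finite[OF monic_of_ne_0])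

text \<open>This makes counting roots first-order: at least \<open>k\<close> roots means
  \<open>k\<close> pairwise distinct witnesses.\<close>

lemma le_card_iff_inj:
  assumes "finite A"
  shows "k \<le> card A \<longleftrightarrow> (\<exists>f. (\<forall>i<k. f i \<in> A) \<and> (\<forall>i<k. \<forall>j<k. f i = f j \<longrightarrow> i = j))"
proof
  assume "k \<le> card A"
  then obtain f where "inj_on f {..<k}" "f ` {..<k} \<subseteq> A"
    using assms card_le_inj[of "{..<k}" A] by auto
  then show "\<exists>f. (\<forall>i<k. f i \<in> A) \<and> (\<forall>i<k. \<forall>j<k. f i = f j \<longrightarrow> i = j)"
    by (intro exI[of _ f]) (auto simp: inj_on_def)
next
  assume "\<exists>f. (\<forall>i<k. f i \<in> A) \<and> (\<forall>i<k. \<forall>j<k. f i = f j \<longrightarrow> i = j)"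
  then obtain f where "inj_on f {..<k}" "f ` {..<k} \<subseteq> A"
    by (auto simp: inj_on_def)
  then show "k \<le> card A" using card_inj_on_le[OF _ _ assms] by force
qed

section \<open>Open and definable sets of coefficients in the presence of a dimension\<close>

locale field_with_dimension = embedded_field M e \<iota>
  for M :: "('f, 'r, 'm) fo_structure" and e and \<iota> :: "'k::field \<Rightarrow> nat \<Rightarrow> 'm" +
  fixes dim :: "nat \<Rightarrow> (nat \<Rightarrow> 'k) set \<Rightarrow> nat extended" and \<tau> :: "'k topology"
  assumes dim_field: "dim 1 (tuples 1) > 0"
    and dim_pos: "\<And>n A. definable_in_power M e \<iota> n A \<Longrightarrow> dim n A > 0 \<Longrightarrow> infinite A"
    and dim_union: "\<And>n A B. definable_in_power M e \<iota> n A \<Longrightarrow> definable_in_power M e \<iota> n B \<Longrightarrow>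
      dim n (A \<union> B) = max (dim n A) (dim n B)"
    and dim_finite_fibers: "\<And>n m A B f. definable_in_power M e \<iota> n A \<Longrightarrow>
      definable_in_power M e \<iota> m B \<Longrightarrow>
      definable_in_power M e \<iota> (n + m) (tgraph n A (\<lambda>x. {f x})) \<Longrightarrow>
      f ` A = B \<Longrightarrow> (\<And>y. y \<in> B \<Longrightarrow> finite {x \<in> A. f x = y}) \<Longrightarrow>
      dim n A = dim m B"
    and ft: "field_topology \<tau>" and dt: "definable_topology M e \<iota> \<tau>"
    and dim_interior: "\<And>n A. definable_in_power M e \<iota> n A \<Longrightarrow>
      dim n A = dim n (tuples n) \<longleftrightarrow> power_topology \<tau> n interior_of A \<noteq> {}"
    and dim_discontinuity: "\<And>n m k U f. definable_in_power M e \<iota> n U \<Longrightarrow> U \<noteq> {} \<Longrightarrow>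
      openin (power_topology \<tau> n) U \<Longrightarrow> correspondence k U (tuples m) f \<Longrightarrow>
      definable_in_power M e \<iota> (n + m) (tgraph n U f) \<Longrightarrow>
      dim n {a \<in> U. \<not> correspondence_continuous_at k
               (subtopology (power_topology \<tau> n) U) (power_topology \<tau> m) f a}
        < dim n (tuples n)"
begin

lemma topspace_\<tau> [simp]: "topspace \<tau> = UNIV"
  using ft by (rule field_topology_topspace)

lemma kdef_set: "kdef (\<lambda>v w. R v) \<Longrightarrow> definable_in_power M e \<iota> n {x \<in> tuples n. R x}"
  using definable_in_power_of_kdef[of "\<lambda>v w. R v" n] by simp

lemma dim_open:
  "definable_in_power M e \<iota> n A \<Longrightarrow> openin (power_topology \<tau> n) A \<Longrightarrow> A \<noteq> {} \<Longrightarrow>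
     dim n A = dim n (tuples n)"
  by (simp add: dim_interior interior_of_openin)

text \<open>Additivity under unions is iterated. The empty union cannot have full dimension, since
  the empty set has empty interior.\<close>

lemma dim_finite_union:
  assumes "\<And>k. definable_in_power M e \<iota> n (A k)" "dim n (\<Union>k<(m::nat). A k) = dim n (tuples n)"
  shows "\<exists>k<m. dim n (A k) = dim n (tuples n)"
  using assms(2)
proof (induction m)
  case 0
  have "definable_in_power M e \<iota> n {}" using kdef_set[OF kdef_const, of n False] by simp
  then show ?case using 0 dim_interior[of n "{}"] by simp
next
  case (Suc m)
  have "definable_in_power M e \<iota> n (\<Union>k<m. A k)"
  proof -
    have "kdef (\<lambda>v w. \<not> (\<forall>k\<in>{..<m}. \<not> restrict v {..<n} \<in> A k))"
      by (intro kdef_not kdef_ball_finite kdef_of_definable_in_power assms(1)) simp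
    from kdef_set[OF this, of n]
    have "definable_in_power M e \<iota> n {x \<in> tuples n. \<not> (\<forall>k\<in>{..<m}. restrict x {..<n} \<notin> A k)}" .
    moreover have "{x \<in> tuples n. \<not> (\<forall>k\<in>{..<m}. restrict x {..<n} \<notin> A k)} = (\<Union>k<m. A k)"
    proof -
      have A: "A k \<subseteq> tuples n" for k using assms(1)[of k] by (simp add: definable_in_power_def)
      have restrict: "restrict x {..<n} = x" if "x \<in> tuples n" for x :: "nat \<Rightarrow> 'k"
        using that by (auto simp: PiE_iff intro: extensional_restrict)
      show ?thesis
      proof (intro equalityI subsetI)
        fix x assume "x \<in> (\<Union>k<m. A k)"
        then obtain k where k: "k < m" "x \<in> A k" by blast
        then have "x \<in> tuples n" using A by blast
        with k restrict show "x \<in> {x \<in> tuples n. \<not> (\<forall>k\<in>{..<m}. restrict x {..<n} \<notin> A k)}"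
          by auto
      qed (use restrict in auto)
    qed
    ultimately show ?thesis by simp
  qed
  from dim_union[OF this assms(1)[of m]]
  have "max (dim n (\<Union>k<m. A k)) (dim n (A m)) = dim n (tuples n)"
    using Suc.prems by (simp add: lessThan_Suc Un_commute)
  then consider "dim n (\<Union>k<m. A k) = dim n (tuples n)" | "dim n (A m) = dim n (tuples n)"
    by (metis max_def)
  then show ?case using Suc.IH by cases (auto intro: less_SucI)
qed

lemma open_box:
  assumes "\<And>i. i < n \<Longrightarrow> openin \<tau> (U i)"
  shows "openin (power_topology \<tau> n) {x \<in> tuples n. \<forall>i<n. x i \<in> U i}"
proof -
  have "{x \<in> tuples n. \<forall>i<n. x i \<in> U i} = PiE {..<n} U"
    by (auto simp: PiE_def Pi_def)
  moreover have "openin (power_topology \<tau> n) (PiE {..<n} U)"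
    unfolding openin_PiE_gen using assms by auto
  ultimately show ?thesis by (simp only:)
qed

lemma box_in_open:
  assumes "openin (power_topology \<tau> n) V" "x \<in> V"
  obtains U where "\<And>i. openin \<tau> (U i)" "\<And>i. i < n \<Longrightarrow> x i \<in> U i"
    "{y \<in> tuples n. \<forall>i<n. y i \<in> U i} \<subseteq> V"
proof -
  obtain U where U: "x \<in> (\<Pi>\<^sub>E i\<in>{..<n}. U i)" "\<forall>i. openin \<tau> (U i)" "(\<Pi>\<^sub>E i\<in>{..<n}. U i) \<subseteq> V"
    using product_topology_open_contains_basis[OF assms] by blast
  have eq: "{y \<in> tuples n. \<forall>i<n. y i \<in> U i} = (\<Pi>\<^sub>E i\<in>{..<n}. U i)"
    by (auto simp: PiE_def Pi_def)
  show ?thesis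
  proof (rule that)
    show "openin \<tau> (U i)" for i using U(2) by blast
    show "i < n \<Longrightarrow> x i \<in> U i" for i using PiE_mem[OF U(1)] by simp
    show "{y \<in> tuples n. \<forall>i<n. y i \<in> U i} \<subseteq> V" using U(3) by (simp only: eq)
  qed
qed

lemma polyfun_continuous_line:
  assumes "polyfun F"
  shows "continuous_map \<tau> \<tau> (\<lambda>y. F (\<lambda>i. y))"
  using polyfun_continuous[OF ft _ assms, of \<tau> "\<lambda>y i. y"] by simp

text \<open>The set {0} is finite, so its dimension is not positive and its complement has full
  dimension. The complement thus contains a non-empty open set, and scaling moves this set to a
  neighborhood of any nonzero point while still avoiding 0.\<close>

lemma open_nonzero: "openin \<tau> (- {0})"
proof -
  let ?Z = "{x \<in> tuples 1. x 0 = (0::'k)}" and ?N = "{x \<in> tuples 1. x 0 \<noteq> (0::'k)}"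
  have def: "definable_in_power M e \<iota> 1 ?Z" "definable_in_power M e \<iota> 1 ?N"
    by (intro kdef_set kdef_not kdef_eq_const)+
  have "?Z \<subseteq> {\<lambda>i\<in>{..<1}. 0}"
    by (auto simp: PiE_iff extensional_def fun_eq_iff)
  then have "finite ?Z" by (rule finite_subset) simp
  then have "\<not> dim 1 ?Z > 0" using dim_pos def(1) by blast
  moreover have "?Z \<union> ?N = tuples 1" by auto
  then have "dim 1 (tuples 1) = max (dim 1 ?Z) (dim 1 ?N)"
    using dim_union[OF def] by simp
  ultimately have "dim 1 ?N = dim 1 (tuples 1)"
    using dim_field by (auto simp: max_def split: if_splits)
  then have "power_topology \<tau> 1 interior_of ?N \<noteq> {}" using dim_interior def(2) by blast
  then obtain x where x: "x \<in> power_topology \<tau> 1 interior_of ?N" by blast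
  obtain U where U: "\<And>i. openin \<tau> (U i)" "\<And>i. i < 1 \<Longrightarrow> x i \<in> U i"
    "{y \<in> tuples 1. \<forall>i<1. y i \<in> U i} \<subseteq> power_topology \<tau> 1 interior_of ?N"
    by (rule box_in_open[OF openin_interior_of x]) blast
  have sub: "{y \<in> tuples 1. \<forall>i<1. y i \<in> U i} \<subseteq> ?N"
    by (rule subset_trans[OF U(3) interior_of_subset])
  have "(\<lambda>i\<in>{..<1}. y) \<in> ?N" if "y \<in> U 0" for y
    using that by (intro subsetD[OF sub]) auto
  then have U0: "0 \<notin> U 0" by force
  have x0: "x 0 \<in> U 0" using U(2) by simp
  show ?thesis
  proof (subst openin_subopen, intro ballI)
    fix z :: 'k assume "z \<in> - {0}"
    define c where "c = x 0 / z"
    have c: "z * c = x 0" using \<open>z \<in> - {0}\<close> by (simp add: c_def)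
    have "continuous_map \<tau> \<tau> (\<lambda>y. y * c)"
      using polyfun_continuous_line[OF polyfun.mult[OF polyfun.var[of 0] polyfun.const[of c]]] by simp
    from openin_continuous_preimage[OF this U(1)[of 0]] have "openin \<tau> {y. y * c \<in> U 0}" by simp
    moreover have "{y. y * c \<in> U 0} \<subseteq> - {0}" using U0 by auto
    ultimately show "\<exists>T. openin \<tau> T \<and> z \<in> T \<and> T \<subseteq> - {0}"
      using c x0 by (intro exI[of _ "{y. y * c \<in> U 0}"]) simp
  qed
qed

lemma open_translate: "openin \<tau> U \<Longrightarrow> openin \<tau> {y. y + c \<in> U}"
proof -
  assume U: "openin \<tau> U"
  have "continuous_map \<tau> \<tau> (\<lambda>y. y + c)"
    using polyfun_continuous_line[OF polyfun.add[OF polyfun.var[of 0] polyfun.const[of c]]] by simp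
  from openin_continuous_preimage[OF this U] show ?thesis by simp
qed

text \<open>Neighborhoods of \<open>p\<close> are replaced by translates of cubes W^d with one basic
  neighborhood W of 0. A single index \<open>b'\<close> is then quantified instead of one index per
  coordinate.\<close>

lemma definable_unstable: "definable_in_power M e \<iota> d (unstable \<tau> d)"
proof -
  obtain nb where nb: "\<And>b. openin \<tau> (nb b)"
    "\<And>U x. openin \<tau> U \<Longrightarrow> x \<in> U \<Longrightarrow> \<exists>b. x \<in> nb b \<and> nb b \<subseteq> U"
    "\<And>j. kdef (\<lambda>v w. v 0 \<in> nb (w j))"
    by (rule kdef_basic_open[OF dt]) blast
  have kdef_nb: "kdef (\<lambda>v w. F v \<in> nb (w j))" if "polyfun F" for F j
    by (rule kdef_polyfun[OF nb(3) that])
  define near where "near p p' b \<longleftrightarrow> (\<forall>i<d. p' i - p i \<in> nb b)" for p p' :: "nat \<Rightarrow> 'k" and b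
  define free where "free p' b \<longleftrightarrow> (\<forall>y. y \<in> nb b \<longrightarrow> poly (monic_of d p') y \<noteq> 0)"
    for p' :: "nat \<Rightarrow> 'k" and b
  define Bad where "Bad p \<longleftrightarrow> (\<exists>x. poly (monic_of d p) x = 0 \<and> (\<exists>b. x \<in> nb b \<and>
      (\<forall>b'. 0 \<in> nb b' \<longrightarrow> (\<exists>p'. near p p' b' \<and> free p' b))))" for p
  \<comment> \<open>Places below \<open>d\<close> hold \<open>p\<close>, the next \<open>d\<close>
    places hold \<open>p'\<close>, and place \<open>2 * d\<close> holds \<open>y\<close>. After
    \<open>p'\<close> is quantified away, place \<open>d\<close> is reused for \<open>x\<close>. The
    tuple variables 0 and 1 hold \<open>b\<close> and \<open>b'\<close>.\<close>
  have "kdef (\<lambda>v w. v (2 * d) \<in> nb (w 0) \<longrightarrow> poly (monic_of d (\<lambda>i. v (d + i))) (v (2 * d)) \<noteq> 0)"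
    by (intro kdef_imp kdef_not kdef_nb kdef_polyfun_zero polyfun_poly polyfun.var)
  from kdef_all[OF this, of "2 * d"]
  have free: "kdef (\<lambda>v w. free (\<lambda>i. v (d + i)) (w 0))"
    unfolding free_def by (simp add: poly_monic_of)
  have near: "kdef (\<lambda>v w. near v (\<lambda>i. v (d + i)) (w 1))"
    unfolding near_def using kdef_ball_finite[of "{..<d}" "\<lambda>i v w. v (d + i) - v i \<in> nb (w 1)"]
    by (simp add: kdef_nb polyfun_diff polyfun.var Ball_def)
  \<comment> \<open>Quantifying \<open>p'\<close> means quantifying its block of places;
    \<open>near\<close> and \<open>free\<close> look only at indices below \<open>d\<close>, so the
    other places are harmless.\<close>
  have block: "(\<exists>v'. near (\<lambda>x. if x \<in> {d..<2 * d} then v' x else v x)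
        (\<lambda>i. if d + i \<in> {d..<2 * d} then v' (d + i) else v (d + i)) b' \<and>
        free (\<lambda>i. if d + i \<in> {d..<2 * d} then v' (d + i) else v (d + i)) b) =
      (\<exists>p'. near v p' b' \<and> free p' b)" for v b b'
  proof
    assume "\<exists>v'. near (\<lambda>x. if x \<in> {d..<2 * d} then v' x else v x)
        (\<lambda>i. if d + i \<in> {d..<2 * d} then v' (d + i) else v (d + i)) b' \<and>
        free (\<lambda>i. if d + i \<in> {d..<2 * d} then v' (d + i) else v (d + i)) b"
    then obtain v' where "near (\<lambda>x. if x \<in> {d..<2 * d} then v' x else v x)
        (\<lambda>i. if d + i \<in> {d..<2 * d} then v' (d + i) else v (d + i)) b'"
        "free (\<lambda>i. if d + i \<in> {d..<2 * d} then v' (d + i) else v (d + i)) b" by blast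
    then have "near v (\<lambda>i. v' (d + i)) b'" "free (\<lambda>i. v' (d + i)) b"
      by (simp_all add: near_def free_def poly_monic_of)
    then show "\<exists>p'. near v p' b' \<and> free p' b" by blast
  next
    assume "\<exists>p'. near v p' b' \<and> free p' b"
    then obtain p' where "near v p' b'" "free p' b" by blast
    then show "\<exists>v'. near (\<lambda>x. if x \<in> {d..<2 * d} then v' x else v x)
        (\<lambda>i. if d + i \<in> {d..<2 * d} then v' (d + i) else v (d + i)) b' \<and>
        free (\<lambda>i. if d + i \<in> {d..<2 * d} then v' (d + i) else v (d + i)) b"
      by (intro exI[of _ "\<lambda>x. p' (x - d)"]) (simp add: near_def free_def poly_monic_of)
  qed
  have "kdef (\<lambda>v w. \<exists>p'. near v p' (w 1) \<and> free p' (w 0))"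
    using kdef_ex_finite[OF _ kdef_conj[OF near free], of "{d..<2 * d}"] by (simp only: block) simp
  then have "kdef (\<lambda>v w. v d \<in> nb (w 0) \<and> (0 \<in> nb (w 1) \<longrightarrow> (\<exists>p'. near v p' (w 1) \<and> free p' (w 0))))"
    by (intro kdef_conj kdef_imp kdef_nb polyfun.intros)
  from kdef_ex_tuple[OF kdef_all_tuple[OF this, of 1], of 0]
  have "kdef (\<lambda>v w. \<exists>b. v d \<in> nb b \<and> (\<forall>b'. 0 \<in> nb b' \<longrightarrow> (\<exists>p'. near v p' b' \<and> free p' b)))"
    by simp
  then have "kdef (\<lambda>v w. poly (monic_of d v) (v d) = 0 \<and>
      (\<exists>b. v d \<in> nb b \<and> (\<forall>b'. 0 \<in> nb b' \<longrightarrow> (\<exists>p'. near v p' b' \<and> free p' b))))"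
    by (intro kdef_conj kdef_polyfun_zero polyfun_poly polyfun.var)
  from kdef_ex[OF this, of d] have "kdef (\<lambda>v w. Bad v)"
    unfolding Bad_def near_def by (simp add: poly_monic_of)
  then have "definable_in_power M e \<iota> d {p \<in> tuples d. Bad p}" by (rule kdef_set)
  moreover have "Bad p \<longleftrightarrow> (\<exists>x. poly (monic_of d p) x = 0 \<and> \<not> stable_root \<tau> d p x)"
    if p: "p \<in> tuples d" for p
  proof -
    have "(\<exists>b. x \<in> nb b \<and> (\<forall>b'. 0 \<in> nb b' \<longrightarrow> (\<exists>p'. near p p' b' \<and> free p' b))) \<longleftrightarrow>
        \<not> stable_root \<tau> d p x" for x
    proof
      assume "\<exists>b. x \<in> nb b \<and> (\<forall>b'. 0 \<in> nb b' \<longrightarrow> (\<exists>p'. near p p' b' \<and> free p' b))"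
      then obtain b where b: "x \<in> nb b" "\<And>b'. 0 \<in> nb b' \<Longrightarrow> \<exists>p'. near p p' b' \<and> free p' b" by blast
      show "\<not> stable_root \<tau> d p x"
      proof
        assume "stable_root \<tau> d p x"
        then obtain V where V: "openin (power_topology \<tau> d) V" "p \<in> V"
          "\<forall>p'\<in>V. \<exists>y\<in>nb b. poly (monic_of d p') y = 0"
          using nb(1) b(1) unfolding stable_root_def by blast
        obtain U where U: "\<And>i. openin \<tau> (U i)" "\<And>i. i < d \<Longrightarrow> p i \<in> U i"
          "{y \<in> tuples d. \<forall>i<d. y i \<in> U i} \<subseteq> V"
          by (rule box_in_open[OF V(1,2)]) blast
        \<comment> \<open>Translating the sides of a box around \<open>p\<close> to 0 and
          intersecting them gives one neighborhood of 0 that fits in all coordinates.\<close>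
        define O' where "O' = (\<Inter>i\<in>{..<d}. {y. y + p i \<in> U i}) \<inter> topspace \<tau>"
        have "openin \<tau> O'"
          unfolding O'_def by (intro openin_INT open_translate U(1)) simp
        moreover have "0 \<in> O'" using U(2) by (simp add: O'_def)
        ultimately obtain b' where b': "0 \<in> nb b'" "nb b' \<subseteq> O'" using nb(2) by blast
        then obtain p' where p': "near p p' b'" "free p' b" using b(2) by blast
        have "p' i \<in> U i" if "i < d" for i
        proof -
          have "p' i - p i \<in> O'" using p'(1) that b'(2) unfolding near_def by blast
          then have "p' i - p i + p i \<in> U i" using that unfolding O'_def by blast
          then show ?thesis by simp
        qed
        then have "restrict p' {..<d} \<in> V" by (intro subsetD[OF U(3)]) auto
        then obtain y where "y \<in> nb b" "poly (monic_of d (restrict p' {..<d})) y = 0"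
          using V(3) by blast
        then show False using p'(2) by (simp add: free_def poly_monic_of_restrict)
      qed
    next
      assume "\<not> stable_root \<tau> d p x"
      then obtain U where U: "openin \<tau> U" "x \<in> U"
        and no_V: "\<not> (\<exists>V. openin (power_topology \<tau> d) V \<and> p \<in> V \<and> (\<forall>p'\<in>V. \<exists>y\<in>U. poly (monic_of d p') y = 0))"
        unfolding stable_root_def by blast
      obtain b where b: "x \<in> nb b" "nb b \<subseteq> U" using nb(2)[OF U(1,2)] by blast
      have "\<exists>p'. near p p' b' \<and> free p' b" if b': "0 \<in> nb b'" for b'
      proof -
        define V where "V = {p' \<in> tuples d. \<forall>i<d. p' i \<in> {y. y + - p i \<in> nb b'}}"
        have "openin (power_topology \<tau> d) V"
          unfolding V_def by (intro open_box open_translate nb(1))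
        moreover have "p \<in> V" using p b' by (simp add: V_def)
        ultimately have "\<exists>p'\<in>V. \<forall>y\<in>U. poly (monic_of d p') y \<noteq> 0" 
          using no_V by blast
        then obtain p' where p': "p' \<in> V" "\<forall>y\<in>U. poly (monic_of d p') y \<noteq> 0" by blast
        have "near p p' b'" using p'(1) by (simp add: near_def V_def)
        moreover have "free p' b" using p'(2) b(2) unfolding free_def by blast
        ultimately show ?thesis by blast
      qed
      with b(1) show "\<exists>b. x \<in> nb b \<and> (\<forall>b'. 0 \<in> nb b' \<longrightarrow> (\<exists>p'. near p p' b' \<and> free p' b))"
        by blast
    qed
    then show ?thesis unfolding Bad_def by simp
  qed
  then have "{p \<in> tuples d. Bad p} = unstable \<tau> d" by (auto simp: unstable_def)
  ultimately show ?thesis by simp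
qed

lemma definable_card_roots:
  "definable_in_power M e \<iota> d {p \<in> tuples d. card {x. poly (monic_of d p) x = 0} = k}"
proof -
  have "kdef (\<lambda>v w. k \<le> card {x. poly (monic_of d v) x = 0})" for k
  proof -
    have "kdef (\<lambda>v w. (\<forall>i\<in>{..<k}. poly (monic_of d v) (v (d + i)) = 0) \<and>
        (\<forall>i\<in>{..<k}. \<forall>j\<in>{..<k}. v (d + i) = v (d + j) \<longrightarrow> i = j))"
      by (intro kdef_conj kdef_ball_finite kdef_imp kdef_eq kdef_const kdef_polyfun_zero
          polyfun_poly polyfun.var) simp_all
    from kdef_ex_finite[OF _ this, of "{d..<d + k}"]
    have *: "kdef (\<lambda>v w. \<exists>v'. (\<forall>i<k. poly (monic_of d v) (v' (d + i)) = 0) \<and>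
        (\<forall>i<k. \<forall>j<k. v' (d + i) = v' (d + j) \<longrightarrow> i = j))"
      by (simp add: poly_monic_of Ball_def cong: conj_cong imp_cong)
    have "(\<exists>v'. (\<forall>i<k. poly (monic_of d v) (v' (d + i)) = 0) \<and>
        (\<forall>i<k. \<forall>j<k. v' (d + i) = v' (d + j) \<longrightarrow> i = j)) \<longleftrightarrow>
        (\<exists>f. (\<forall>i<k. poly (monic_of d v) (f i) = 0) \<and>
        (\<forall>i<k. \<forall>j<k. f i = f j \<longrightarrow> i = j))" (is "?L \<longleftrightarrow> ?R")
      for v :: "nat \<Rightarrow> 'k"
    proof
      assume ?L
      then obtain v' where v': "(\<forall>i<k. poly (monic_of d v) (v' (d + i)) = 0) \<and>
        (\<forall>i<k. \<forall>j<k. v' (d + i) = v' (d + j) \<longrightarrow> i = j)" ..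
      then show ?R by (intro exI[of _ "\<lambda>i. v' (d + i)"])
    next
      assume ?R
      then obtain f where f: "(\<forall>i<k. poly (monic_of d v) (f i) = 0) \<and>
        (\<forall>i<k. \<forall>j<k. f i = f j \<longrightarrow> i = j)" ..
      then show ?L by (intro exI[of _ "\<lambda>x. f (x - d)"]) simp
    qed
    then have "(\<exists>v'. (\<forall>i<k. poly (monic_of d v) (v' (d + i)) = 0) \<and>
        (\<forall>i<k. \<forall>j<k. v' (d + i) = v' (d + j) \<longrightarrow> i = j)) \<longleftrightarrow>
        k \<le> card {x. poly (monic_of d v) x = 0}" for v :: "nat \<Rightarrow> 'k"
      using le_card_iff_inj[OF finite_roots, of k d v] by simp
    with * show ?thesis by simp
  qed
  then have "kdef (\<lambda>v w. k \<le> card {x. poly (monic_of d v) x = 0} \<and>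
      \<not> Suc k \<le> card {x. poly (monic_of d v) x = 0})"
    by (intro kdef_conj kdef_not)
  then have "definable_in_power M e \<iota> d {p \<in> tuples d. k \<le> card {x. poly (monic_of d p) x = 0} \<and>
      \<not> Suc k \<le> card {x. poly (monic_of d p) x = 0}}"
    by (rule kdef_set)
  moreover have "k \<le> n \<and> \<not> Suc k \<le> n \<longleftrightarrow> n = k" for n by auto
  ultimately show ?thesis by simp
qed

end

section \<open>Root correspondences and the interior of the unstable set\<close>

context field_with_dimension
begin

lemma definable_box:
  assumes "\<And>i. kdef (\<lambda>v w. v 0 \<in> U i)"
  shows "kdef (\<lambda>v w. \<forall>i\<in>{..<n}. v i \<in> U i)"
  using kdef_polyfun[OF assms polyfun.var] by (intro kdef_ball_finite) simp_all

text \<open>With exactly \<open>k\<close> roots everywhere, the roots form a k-correspondence on the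
  box. At a point of continuity every root lies on a continuous branch, hence is stable. So on
  unstable points the correspondence is discontinuous everywhere, and a non-empty box would have
  less than full dimension.\<close>

lemma unstable_box_empty:
  assumes U: "U = {p \<in> tuples d. \<forall>i\<in>{..<d}. p i \<in> B i}"
    and B: "\<And>i. openin \<tau> (B i)" "\<And>i. kdef (\<lambda>v w. v 0 \<in> B i)"
    and sub: "U \<subseteq> unstable \<tau> d" and card: "\<And>p. p \<in> U \<Longrightarrow> card {x. poly (monic_of d p) x = 0} = k"
  shows "U = {}"
proof (rule ccontr)
  assume "U \<noteq> {}"
  \<comment> \<open>Correspondences take values in powers of the field, so roots are wrapped as
    1-tuples.\<close>
  define f where "f p = (\<lambda>x. \<lambda>i\<in>{..<(1::nat)}. x) ` {x. poly (monic_of d p) x = 0}" for p :: "nat \<Rightarrow> 'k"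
  have U_open: "openin (power_topology \<tau> d) U"
    using open_box[of d B] B(1) by (simp add: U Ball_def)
  have U_def: "definable_in_power M e \<iota> d U"
    unfolding U by (intro kdef_set definable_box B(2))
  have inj: "inj (\<lambda>x. \<lambda>i\<in>{..<(1::nat)}. x :: 'k)"
    by (rule injI) (metis lessThan_iff less_one restrict_apply')
  have corr: "correspondence k U (tuples 1) f"
    unfolding correspondence_def
  proof (intro ballI conjI)
    fix p assume "p \<in> U"
    show "f p \<subseteq> tuples 1" by (auto simp: f_def split: if_splits)
    show "finite (f p)" unfolding f_def by (rule finite_imageI[OF finite_roots])
    show "card (f p) = k"
      unfolding f_def using card[OF \<open>p \<in> U\<close>] card_image[OF inj_on_subset[OF inj subset_UNIV]] by metis
  qed
  have graph: "tgraph d U f = {z \<in> tuples (d + 1). (\<forall>i\<in>{..<d}. z i \<in> B i) \<and> poly (monic_of d z) (z d) = 0}"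
  proof (intro equalityI subsetI)
    fix z assume "z \<in> tgraph d U f"
    then obtain p x where z: "z = tappend d p (\<lambda>i\<in>{..<1}. x)" "p \<in> U" "poly (monic_of d p) x = 0"
      unfolding tgraph_def f_def by blast
    have "monic_of d z = monic_of d p" by (rule monic_of_cong) (simp add: z(1) tappend_def)
    then show "z \<in> {z \<in> tuples (d + 1). (\<forall>i\<in>{..<d}. z i \<in> B i) \<and> poly (monic_of d z) (z d) = 0}"
      using z(2,3) by (auto simp: z(1) tappend_def U PiE_iff extensional_def)
  next
    fix z assume z: "z \<in> {z \<in> tuples (d + 1). (\<forall>i\<in>{..<d}. z i \<in> B i) \<and> poly (monic_of d z) (z d) = 0}"
    have "z = tappend d (restrict z {..<d}) (\<lambda>i\<in>{..<1}. z d)"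
    proof
      fix i
      show "z i = tappend d (restrict z {..<d}) (\<lambda>i\<in>{..<1}. z d) i"
      proof (cases "i < d + 1")
        case True
        then show ?thesis by (cases "i = d") (auto simp: tappend_def)
      next
        case False
        then show ?thesis using z by (auto simp: tappend_def PiE_iff extensional_def)
      qed
    qed
    moreover have "restrict z {..<d} \<in> U" using z by (simp add: U)
    moreover have "(\<lambda>i\<in>{..<1}. z d) \<in> f (restrict z {..<d})"
      using z by (simp add: f_def poly_monic_of_restrict)
    ultimately show "z \<in> tgraph d U f" unfolding tgraph_def by blast
  qed
  have graph_def: "definable_in_power M e \<iota> (d + 1) (tgraph d U f)"
    unfolding graph
    by (intro kdef_set kdef_conj definable_box B(2) kdef_polyfun_zero polyfun_poly polyfun.var)
  have "\<not> correspondence_continuous_at k (subtopology (power_topology \<tau> d) U) (power_topology \<tau> 1) f p"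
    if p: "p \<in> U" for p
  proof
    assume "correspondence_continuous_at k (subtopology (power_topology \<tau> d) U) (power_topology \<tau> 1) f p"
    then obtain N g where N: "openin (subtopology (power_topology \<tau> d) U) N" "p \<in> N"
      and g: "\<And>i. i < k \<Longrightarrow> continuous_map (subtopology (subtopology (power_topology \<tau> d) U) N) (power_topology \<tau> 1) (g i)"
      and f_eq: "\<And>x. x \<in> N \<Longrightarrow> f x = {g i x | i. i < k}"
      unfolding correspondence_continuous_at_def by blast
    have N_open: "openin (power_topology \<tau> d) N" and NU: "N \<subseteq> U"
      using N(1) U_open openin_open_subtopology by blast+
    obtain x where x: "poly (monic_of d p) x = 0" "\<not> stable_root \<tau> d p x"
      using p sub unfolding unstable_def by blast
    have "(\<lambda>i\<in>{..<1}. x) \<in> f p" using x(1) by (simp add: f_def)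
    then obtain i where i: "i < k" "(\<lambda>i\<in>{..<1}. x) = g i p" using f_eq[OF N(2)] by auto
    have gip: "g i p 0 = x" using fun_cong[OF i(2), of 0] by simp
    have "stable_root \<tau> d p x"
      unfolding stable_root_def
    proof (intro allI impI)
      fix W assume W: "openin \<tau> W \<and> x \<in> W"
      \<comment> \<open>This is the preimage of \<open>W\<close> under the branch passing through
        \<open>x\<close> at \<open>p\<close>; the branch values are the required roots.\<close>
      define V where "V = {z \<in> N. g i z 0 \<in> W}"
      have "subtopology (subtopology (power_topology \<tau> d) U) N = subtopology (power_topology \<tau> d) N"
        using NU by (simp add: subtopology_subtopology inf.absorb2)
      then have "continuous_map (subtopology (power_topology \<tau> d) N) \<tau> ((\<lambda>z. z 0) \<circ> g i)"
        using continuous_map_compose[OF g[OF i(1)] continuous_coordinate[OF topspace_\<tau>]] by simp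
      from openin_continuous_preimage[OF this, of W]
      have "openin (subtopology (power_topology \<tau> d) N) {z \<in> tuples d \<inter> N. g i z 0 \<in> W}"
        using W by simp
      moreover have "tuples d \<inter> N = N" using openin_subset[OF N_open] by auto
      ultimately have "openin (power_topology \<tau> d) V"
        using N_open openin_open_subtopology unfolding V_def by metis
      moreover have "p \<in> V" using N(2) gip W by (simp add: V_def)
      moreover have "\<exists>y\<in>W. poly (monic_of d p') y = 0" if "p' \<in> V" for p'
      proof -
        have "g i p' \<in> f p'" using that i(1) f_eq[of p'] by (auto simp: V_def)
        then obtain y where y: "poly (monic_of d p') y = 0" "g i p' = (\<lambda>i\<in>{..<1}. y)"
          by (auto simp: f_def)
        then have "g i p' 0 = y" by simp
        then show ?thesis using that y(1) by (auto simp: V_def)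
      qed
      ultimately show "\<exists>V. openin (power_topology \<tau> d) V \<and> p \<in> V \<and>
          (\<forall>p'\<in>V. \<exists>y\<in>W. poly (monic_of d p') y = 0)" by blast
    qed
    with x(2) show False by blast
  qed
  then have "{p \<in> U. \<not> correspondence_continuous_at k (subtopology (power_topology \<tau> d) U)
      (power_topology \<tau> 1) f p} = U" by blast
  then have "dim d U < dim d (tuples d)"
    using dim_discontinuity[OF U_def \<open>U \<noteq> {}\<close> U_open corr graph_def] by simp
  then show False using dim_open[OF U_def U_open \<open>U \<noteq> {}\<close>] by simp
qed

text \<open>A full-dimensional unstable set would have a full-dimensional piece on which the number
  of roots, one of 0, ..., d, is constant. The interior of that piece contains a box with basic open
  sides, which is definable as the discontinuity axiom requires.\<close>

lemma interior_unstable: "power_topology \<tau> d interior_of (unstable \<tau> d) = {}"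
proof (rule ccontr)
  assume "power_topology \<tau> d interior_of (unstable \<tau> d) \<noteq> {}"
  then have full: "dim d (unstable \<tau> d) = dim d (tuples d)"
    using dim_interior definable_unstable by blast
  define A where "A k = {p \<in> tuples d. p \<in> unstable \<tau> d \<and> card {x. poly (monic_of d p) x = 0} = k}" for k
  have A_def': "definable_in_power M e \<iota> d (A k)" for k
  proof -
    have "kdef (\<lambda>v w. restrict v {..<d} \<in> unstable \<tau> d \<and>
        restrict v {..<d} \<in> {p \<in> tuples d. card {x. poly (monic_of d p) x = 0} = k})"
      by (intro kdef_conj kdef_of_definable_in_power definable_unstable definable_card_roots)
    then have "definable_in_power M e \<iota> d {p \<in> tuples d. restrict p {..<d} \<in> unstable \<tau> d \<and>
        restrict p {..<d} \<in> {p \<in> tuples d. card {x. poly (monic_of d p) x = 0} = k}}"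
      by (rule kdef_set)
    moreover have "{p \<in> tuples d. restrict p {..<d} \<in> unstable \<tau> d \<and>
        restrict p {..<d} \<in> {p \<in> tuples d. card {x. poly (monic_of d p) x = 0} = k}} = A k"
    proof -
      have "restrict p {..<d} = p" if "p \<in> tuples d" for p :: "nat \<Rightarrow> 'k"
        using that by (auto simp: PiE_iff intro: extensional_restrict)
      then show ?thesis unfolding A_def by (intro Collect_cong conj_cong) simp_all
    qed
    ultimately show ?thesis by simp
  qed
  have "card {x. poly (monic_of d p) x = 0} < Suc d" for p :: "nat \<Rightarrow> 'k"
    using card_poly_roots_bound[OF monic_of_ne_0[of d p]] by (simp add: degree_monic_of less_Suc_eq_le)
  then have "unstable \<tau> d = (\<Union>k<Suc d. A k)"
    by (auto simp: A_def unstable_def)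
  then obtain k where "dim d (A k) = dim d (tuples d)"
    using dim_finite_union[of d A "Suc d"] A_def' full by metis
  then have "power_topology \<tau> d interior_of (A k) \<noteq> {}"
    using dim_interior A_def' by blast
  then obtain p where p: "p \<in> power_topology \<tau> d interior_of (A k)" by blast
  obtain U where U: "\<And>i. openin \<tau> (U i)" "\<And>i. i < d \<Longrightarrow> p i \<in> U i"
    "{y \<in> tuples d. \<forall>i<d. y i \<in> U i} \<subseteq> power_topology \<tau> d interior_of (A k)"
    by (rule box_in_open[OF openin_interior_of p]) blast
  obtain nb where nb: "\<And>b. openin \<tau> (nb b)"
    "\<And>U x. openin \<tau> U \<Longrightarrow> x \<in> U \<Longrightarrow> \<exists>b. x \<in> nb b \<and> nb b \<subseteq> U"
    "\<And>j. kdef (\<lambda>v w. v 0 \<in> nb (w j))"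
    by (rule kdef_basic_open[OF dt]) blast
  have "\<exists>b. i < d \<longrightarrow> p i \<in> nb b \<and> nb b \<subseteq> U i" for i
    using nb(2)[OF U(1) U(2)] by blast
  then obtain b where b: "\<And>i. i < d \<Longrightarrow> p i \<in> nb (b i)" "\<And>i. i < d \<Longrightarrow> nb (b i) \<subseteq> U i"
    by metis
  define B where "B = {p \<in> tuples d. \<forall>i\<in>{..<d}. p i \<in> nb (b i)}"
  have "B \<subseteq> {y \<in> tuples d. \<forall>i<d. y i \<in> U i}"
    using b(2) by (auto simp: B_def)
  also have "\<dots> \<subseteq> A k"
    by (rule subset_trans[OF U(3) interior_of_subset])
  finally have BA: "B \<subseteq> A k" .
  have "B = {}"
  proof (rule unstable_box_empty[OF B_def])
    show "kdef (\<lambda>v w. v 0 \<in> nb (b i))" for i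
      using kdef_fix_tuples[OF nb(3)[of 0], of "\<lambda>_. b i"] by simp
    show "B \<subseteq> unstable \<tau> d" "\<And>p. p \<in> B \<Longrightarrow> card {x. poly (monic_of d p) x = 0} = k"
      using BA by (auto simp: A_def)
  qed (rule nb(1))
  moreover have "p \<in> tuples d"
    using subsetD[OF interior_of_subset p] by (simp add: A_def)
  then have "p \<in> B" using b(1) by (simp add: B_def)
  ultimately show False by blast
qed

section \<open>A stable presentation and the persistence of roots of separable polynomials\<close>

lemma continuous_mult:
  "continuous_map Z \<tau> F \<Longrightarrow> continuous_map Z \<tau> G \<Longrightarrow> continuous_map Z \<tau> (\<lambda>z. F z * G z)"
  using polyfun_continuous[OF ft _ polyfun.mult[OF polyfun.var[of 0] polyfun.var[of 1]],
      of Z "\<lambda>z i. if i = 0 then F z else G z"] by simp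

lemma polyfun_continuous_power: "polyfun F \<Longrightarrow> continuous_map (power_topology \<tau> n) \<tau> F"
  using polyfun_continuous[OF ft, of "power_topology \<tau> n" "\<lambda>z. z" F]
    continuous_coordinate[OF topspace_\<tau>] by simp

text \<open>Any generator presents the same algebra, and there are too many of them for all
  characteristic polynomials to be unstable.\<close>

lemma exists_stable_generator:
  assumes Q: "Q \<in> monic_polys d" and sep: "separable_poly Q" and d: "0 < d"
  obtains g where "g \<in> tuples d" "power_det d Q (poly_of d g) \<noteq> 0"
    "(\<lambda>i\<in>{..<d}. char_coord d Q (poly_of d g) i) \<notin> unstable \<tau> d"
proof -
  have degQ: "Polynomial.degree Q = d" using Q by (simp add: monic_polys_def)
  define q where "q = Polynomial.coeff Q"
  have Q_eq: "monic_of d q = Q" using Q unfolding q_def by (rule monic_of_coeff)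
  define D where "D g = power_det d Q (poly_of d g)" for g
  define N where "N g i = power_coord d Q (poly_of d g) (poly_of d g ^ d) i" for g i
  define \<phi> where "\<phi> g = (\<lambda>i\<in>{..<d}. char_coord d Q (poly_of d g) i)" for g
  have D_poly: "polyfun (\<lambda>v. D (g v))" if "\<And>i. polyfun (\<lambda>v. g v i)" for g
    using polyfun_power_det[of "\<lambda>v. q" g d, OF polyfun.const that d] by (simp add: D_def Q_eq)
  have N_poly: "polyfun (\<lambda>v. N (g v) i)" if "\<And>i. polyfun (\<lambda>v. g v i)" "i < d" for g i
    using polyfun_power_coord_char[of "\<lambda>v. q" g d, OF polyfun.const that(1) d that(2)]
    by (simp add: N_def Q_eq)
  have D_cong: "D g = D g'" and N_cong: "N g i = N g' i" if "\<And>i. i < d \<Longrightarrow> g i = g' i" for g g' i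
    using that by (simp_all add: D_def N_def cong: poly_of_cong)
  \<comment> \<open>Clearing the denominator describes the graph of \<open>\<phi>\<close> by
    polynomial equations wherever \<open>D\<close> does not vanish; this form serves both the image
    and the graph below.\<close>
  have \<phi>_iff: "c i = char_coord d Q (poly_of d g) i \<longleftrightarrow> c i * D g = - N g i" if "D g \<noteq> 0" for c g i
    using that by (simp add: char_coord_def[OF degQ d] D_def N_def field_simps)
  define G where "G = {g \<in> tuples d. D g \<noteq> 0}"
  have G_open: "openin (power_topology \<tau> d) G"
  proof -
    have "continuous_map (power_topology \<tau> d) \<tau> D"
      by (intro polyfun_continuous_power D_poly polyfun.var)
    from openin_continuous_preimage[OF this open_nonzero] show ?thesis by (simp add: G_def)
  qed
  have G_def': "definable_in_power M e \<iota> d G"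
    unfolding G_def by (intro kdef_set kdef_not kdef_polyfun_zero D_poly polyfun.var)
  have "G \<noteq> {}"
  proof -
    let ?x = "[:0, 1:] mod Q"
    have "Polynomial.degree ?x < d"
      using degree_mod_less[of Q "[:0, 1:]"] degQ d by (cases "Q = 0") auto
    then have "poly_of d (restrict (Polynomial.coeff ?x) {..<d}) = ?x"
      using poly_of_coeff[of ?x d] poly_of_cong[of d "restrict (Polynomial.coeff ?x) {..<d}" "Polynomial.coeff ?x"]
      by simp
    then have "D (restrict (Polynomial.coeff ?x) {..<d}) = 1"
      using power_det_generator[OF degQ d] by (simp add: D_def)
    then have "restrict (Polynomial.coeff ?x) {..<d} \<in> G" by (simp add: G_def)
    then show ?thesis by blast
  qed
  have rel: "D g \<noteq> 0 \<longrightarrow> \<phi> g = c \<longleftrightarrow> D g \<noteq> 0 \<longrightarrow> (\<forall>i\<in>{..<d}. c i * D g = - N g i)"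
    if "c \<in> tuples d" for c g
  proof (cases "D g = 0")
    case False
    have "\<phi> g = c \<longleftrightarrow> (\<forall>i\<in>{..<d}. c i = char_coord d Q (poly_of d g) i)"
      using that by (auto simp: \<phi>_def fun_eq_iff PiE_iff extensional_def)
    then show ?thesis using \<phi>_iff[OF False] by simp
  qed simp
  have image: "\<phi> ` G = {c \<in> tuples d. \<exists>g. D g \<noteq> 0 \<and> (\<forall>i\<in>{..<d}. c i * D g = - N g i)}"
  proof (intro equalityI subsetI)
    fix c assume "c \<in> \<phi> ` G"
    then obtain g where g: "g \<in> G" "\<phi> g = c" by blast
    moreover have "c \<in> tuples d" using g(2) by (auto simp: \<phi>_def split: if_splits)
    ultimately show "c \<in> {c \<in> tuples d. \<exists>g. D g \<noteq> 0 \<and> (\<forall>i\<in>{..<d}. c i * D g = - N g i)}"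
      using rel[of c g] unfolding G_def by blast
  next
    fix c assume "c \<in> {c \<in> tuples d. \<exists>g. D g \<noteq> 0 \<and> (\<forall>i\<in>{..<d}. c i * D g = - N g i)}"
    then obtain g where c: "c \<in> tuples d" and g: "D g \<noteq> 0" "\<forall>i\<in>{..<d}. c i * D g = - N g i" by blast
    let ?g = "restrict g {..<d}"
    have DN: "D ?g = D g" "N ?g i = N g i" for i
      by (rule D_cong N_cong, simp)+
    then have "?g \<in> G" using g(1) by (simp add: G_def)
    moreover have "\<phi> ?g = c" using rel[OF c, of ?g] g DN by simp
    ultimately show "c \<in> \<phi> ` G" by blast
  qed
  have image_def: "definable_in_power M e \<iota> d (\<phi> ` G)"
  proof -
    \<comment> \<open>The first \<open>d\<close> places hold the coefficient vector \<open>c\<close>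
      and the next \<open>d\<close> hold \<open>g\<close>, which is then quantified away.\<close>
    have "kdef (\<lambda>v w. D (\<lambda>i. v (d + i)) \<noteq> 0 \<and> (\<forall>i\<in>{..<d}. v i * D (\<lambda>i. v (d + i)) - - N (\<lambda>i. v (d + i)) i = 0))"
      by (intro kdef_conj kdef_not kdef_ball_finite kdef_polyfun_zero polyfun_diff polyfun_uminus
          polyfun.mult D_poly N_poly polyfun.var) simp_all
    from kdef_ex_finite[OF _ this, of "{d..<2 * d}"]
    have *: "kdef (\<lambda>v w. \<exists>v'. D (\<lambda>i. if d + i \<in> {d..<2 * d} then v' (d + i) else v (d + i)) \<noteq> 0 \<and>
        (\<forall>i\<in>{..<d}. v i * D (\<lambda>i. if d + i \<in> {d..<2 * d} then v' (d + i) else v (d + i)) =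
          - N (\<lambda>i. if d + i \<in> {d..<2 * d} then v' (d + i) else v (d + i)) i))"
      by (simp add: eq_neg_iff_add_eq_0)
    have eq: "D (\<lambda>i. if d + i \<in> {d..<2 * d} then v' (d + i) else v (d + i)) = D (\<lambda>i. v' (d + i))"
      "N (\<lambda>i. if d + i \<in> {d..<2 * d} then v' (d + i) else v (d + i)) j = N (\<lambda>i. v' (d + i)) j" for v v' j
      by (rule D_cong N_cong, simp)+
    have "(\<exists>v'. D (\<lambda>i. v' (d + i)) \<noteq> 0 \<and> (\<forall>i\<in>{..<d}. c i * D (\<lambda>i. v' (d + i)) = - N (\<lambda>i. v' (d + i)) i)) \<longleftrightarrow>
        (\<exists>g. D g \<noteq> 0 \<and> (\<forall>i\<in>{..<d}. c i * D g = - N g i))" for c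
    proof
      assume "\<exists>g. D g \<noteq> 0 \<and> (\<forall>i\<in>{..<d}. c i * D g = - N g i)"
      then obtain g where g: "D g \<noteq> 0 \<and> (\<forall>i\<in>{..<d}. c i * D g = - N g i)" ..
      then show "\<exists>v'. D (\<lambda>i. v' (d + i)) \<noteq> 0 \<and> (\<forall>i\<in>{..<d}. c i * D (\<lambda>i. v' (d + i)) = - N (\<lambda>i. v' (d + i)) i)"
        by (intro exI[of _ "\<lambda>x. g (x - d)"]) simp
    qed blast
    with * show ?thesis unfolding image eq by (intro kdef_set) simp
  qed
  have graph_def: "definable_in_power M e \<iota> (d + d) (tgraph d G (\<lambda>x. {\<phi> x}))"
  proof -
    have "tgraph d G (\<lambda>x. {\<phi> x}) = {z \<in> tuples (d + d). D z \<noteq> 0 \<and>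
        (\<forall>i\<in>{..<d}. z (d + i) * D z - - N z i = 0)}"
    proof (intro equalityI subsetI)
      fix z assume "z \<in> tgraph d G (\<lambda>x. {\<phi> x})"
      then obtain g where g: "z = tappend d g (\<phi> g)" "g \<in> G" unfolding tgraph_def by blast
      have DN: "D z = D g" "N z i = N g i" for i
        by (rule D_cong N_cong, simp add: g(1) tappend_def)+
      have "\<phi> g \<in> tuples d" by (simp add: \<phi>_def)
      then have "\<forall>i\<in>{..<d}. \<phi> g i * D g = - N g i" using rel[of "\<phi> g" g] g(2) by (simp add: G_def)
      moreover have "z \<in> tuples (d + d)"
        using g(2) by (auto simp: g(1) tappend_def \<phi>_def G_def PiE_iff extensional_def)
      moreover have "z (d + i) = \<phi> g i" for i by (simp add: g(1) tappend_def)
      ultimately show "z \<in> {z \<in> tuples (d + d). D z \<noteq> 0 \<and> (\<forall>i\<in>{..<d}. z (d + i) * D z - - N z i = 0)}"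
        using g(2) by (simp add: DN G_def)
    next
      fix z assume z: "z \<in> {z \<in> tuples (d + d). D z \<noteq> 0 \<and> (\<forall>i\<in>{..<d}. z (d + i) * D z - - N z i = 0)}"
      let ?g = "restrict z {..<d}" and ?c = "\<lambda>i\<in>{..<d}. z (d + i)"
      have DN: "D ?g = D z" "N ?g i = N z i" for i
        by (rule D_cong N_cong, simp)+
      have \<phi>_eq: "\<phi> ?g = ?c"
        using rel[of ?c ?g] z by (simp add: DN eq_neg_iff_add_eq_0)
      have z_eq: "z = tappend d ?g ?c"
      proof
        fix i show "z i = tappend d ?g ?c i"
          using z by (cases "i < d + d") (auto simp: tappend_def PiE_iff extensional_def)
      qed
      have "z = tappend d ?g (\<phi> ?g)" unfolding \<phi>_eq by (rule z_eq)
      moreover have "?g \<in> G" using z by (simp add: G_def DN)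
      ultimately show "z \<in> tgraph d G (\<lambda>x. {\<phi> x})" unfolding tgraph_def by blast
    qed
    moreover have "definable_in_power M e \<iota> (d + d) \<dots>"
      by (intro kdef_set kdef_conj kdef_not kdef_ball_finite kdef_polyfun_zero polyfun_diff polyfun_uminus
          polyfun.mult D_poly N_poly polyfun.var) simp_all
    ultimately show ?thesis by simp
  qed
  have fibers: "finite {g \<in> G. \<phi> g = c}" for c
  proof -
    let ?S = "{F. Polynomial.degree F < Polynomial.degree Q \<and> Q dvd pcompose (monic_of d c) F}"
    have "poly_of d ` {g \<in> G. \<phi> g = c} \<subseteq> ?S"
    proof (clarsimp simp: G_def degQ degree_poly_of d)
      fix g assume "D g \<noteq> 0" "c = \<phi> g"
      have "monic_of d (\<phi> g) = monic_of d (char_coord d Q (poly_of d g))"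
        by (rule monic_of_cong) (simp add: \<phi>_def)
      then show "Q dvd pcompose (monic_of d (\<phi> g)) (poly_of d g)"
        using char_coord_dvd[OF degQ d] \<open>D g \<noteq> 0\<close> by (simp add: D_def)
    qed
    moreover have "finite ?S"
      using sep monic_of_ne_0 d degQ by (intro finite_generators_with_char) auto
    moreover have "inj_on (poly_of d) {g \<in> G. \<phi> g = c}"
    proof (rule inj_onI)
      fix g h assume gh: "g \<in> {g \<in> G. \<phi> g = c}" "h \<in> {g \<in> G. \<phi> g = c}" "poly_of d g = poly_of d h"
      have tuples: "g \<in> tuples d" "h \<in> tuples d" using gh by (simp_all add: G_def)
      show "g = h"
      proof (rule PiE_ext[OF tuples])
        fix i assume "i \<in> {..<d}"
        then show "g i = h i" using arg_cong[OF gh(3), of "\<lambda>p. Polynomial.coeff p i"]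
          by (simp add: coeff_poly_of)
      qed
    qed
    ultimately show ?thesis by (meson finite_subset finite_imageD)
  qed
  \<comment> \<open>Elements of the algebra and monic polynomials of degree \<open>d\<close> are
    both described by \<open>d\<close> coordinates, so full dimension at the source is full
    dimension at the target.\<close>
  have "dim d (tuples d) = dim d (\<phi> ` G)"
    using dim_finite_fibers[OF G_def' image_def graph_def refl fibers] dim_open[OF G_def' G_open \<open>G \<noteq> {}\<close>]
    by simp
  then have "power_topology \<tau> d interior_of (\<phi> ` G) \<noteq> {}"
    using dim_interior[OF image_def] by simp
  then have "\<not> \<phi> ` G \<subseteq> unstable \<tau> d"
    using interior_of_mono[of "\<phi> ` G" "unstable \<tau> d" "power_topology \<tau> d"] interior_unstable by blast
  then obtain g where "g \<in> G" "\<phi> g \<notin> unstable \<tau> d" by blast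
  then show ?thesis using that[of g] by (simp add: G_def D_def \<phi>_def)
qed

text \<open>The lift \<open>G\<close> is chosen for \<open>Q\<close> and kept fixed while the
  modulus varies; it remains a generator on the open set \<open>V0\<close>. The root
  \<open>a\<close> corresponds to the stable root \<open>y0\<close> of \<open>C q\<close>, and
  evaluating \<open>H p\<close> carries nearby roots of \<open>C p\<close> back to roots of the
  nearby polynomial.\<close>

lemma root_persists:
  assumes Q: "Q \<in> monic_polys d" and sep: "separable_poly Q" and root: "poly Q a = 0"
  shows "stable_root \<tau> d (restrict (Polynomial.coeff Q) {..<d}) a"
proof -
  \<comment> \<open>In degree 0 the only monic polynomial is 1, which has no root.\<close>
  have d: "0 < d"
  proof (rule ccontr)
    assume "\<not> 0 < d"
    then have "Q = 1" using Q by (auto simp: monic_polys_def elim!: degree_eq_zeroE)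
    then show False using root by simp
  qed
  obtain g where g: "g \<in> tuples d" "power_det d Q (poly_of d g) \<noteq> 0"
    "(\<lambda>i\<in>{..<d}. char_coord d Q (poly_of d g) i) \<notin> unstable \<tau> d"
    by (rule exists_stable_generator[OF Q sep d]) blast
  define G where "G = poly_of d g"
  define q where "q = restrict (Polynomial.coeff Q) {..<d}"
  have q: "q \<in> tuples d" by (simp add: q_def)
  have Q_eq: "monic_of d q = Q"
    using monic_of_coeff[OF Q] monic_of_cong[of d q "Polynomial.coeff Q"] by (simp add: q_def)
  define D where "D p = power_det d (monic_of d p) G" for p
  define C where "C p = (\<lambda>i\<in>{..<d}. char_coord d (monic_of d p) G i)" for p
  define H where "H p = inv_coord d (monic_of d p) G" for p
  note deg = degree_monic_of[of d]
  define V0 where "V0 = {p \<in> tuples d. D p \<noteq> 0}"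
  let ?T = "power_topology \<tau> d" and ?TV = "subtopology (power_topology \<tau> d) V0"
  note cont = polyfun_continuous_power[of _ d]
  have D_cont: "continuous_map ?T \<tau> D"
    unfolding D_def G_def by (intro cont polyfun_power_det polyfun.var polyfun.const d)
  have V0_open: "openin ?T V0"
    using openin_continuous_preimage[OF D_cont open_nonzero] by (simp add: V0_def)
  have topspace_TV: "topspace ?TV = V0" by (auto simp: V0_def)
  have inv_cont: "continuous_map ?TV \<tau> (\<lambda>p. inverse (D p))"
    using D_cont by (intro field_topology_inverse[OF ft] continuous_map_from_subtopology)
      (auto simp: V0_def)
  have C_cont: "continuous_map ?TV ?T C"
    unfolding continuous_map_componentwise
  proof (intro conjI ballI)
    show "C ` topspace ?TV \<subseteq> extensional {..<d}" by (auto simp: C_def)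
    fix i assume i: "i \<in> {..<d}"
    have "continuous_map ?TV \<tau> (\<lambda>p. - power_coord d (monic_of d p) G (G ^ d) i * inverse (D p))"
      using i unfolding G_def
      by (intro continuous_mult inv_cont[unfolded G_def] continuous_map_from_subtopology[OF cont]
          polyfun_uminus polyfun_power_coord_char polyfun.var polyfun.const d) simp
    moreover have "C p i = - power_coord d (monic_of d p) G (G ^ d) i * inverse (D p)" for p
      using i by (simp add: C_def char_coord_def[OF deg d] D_def divide_inverse)
    ultimately show "continuous_map ?TV \<tau> (\<lambda>p. C p i)" by simp
  qed
  have H_cont: "continuous_map ?TV \<tau> (\<lambda>p. H p i)" if "i < d" for i
  proof -
    have "continuous_map ?TV \<tau> (\<lambda>p. power_coord d (monic_of d p) G [:0, 1:] i * inverse (D p))"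
      using that unfolding G_def
      by (intro continuous_mult inv_cont[unfolded G_def] continuous_map_from_subtopology[OF cont]
          polyfun_power_coord_inv polyfun.var polyfun.const d)
    then show ?thesis by (simp add: H_def inv_coord_def[OF deg d] D_def divide_inverse)
  qed
  define ev where "ev = (\<lambda>(p, y). poly (poly_of d (H p)) y)"
  have ev_cont: "continuous_map (prod_topology ?TV \<tau>) \<tau> ev"
  proof -
    \<comment> \<open>The coefficients of \<open>H p\<close> and the argument \<open>y\<close> are
      packed into one assignment, with \<open>y\<close> at place \<open>d\<close>, so that
      evaluation becomes a single polynomial function.\<close>
    define t where "t = (\<lambda>(p, y) i. if i < d then H p i else y)"
    have "continuous_map (prod_topology ?TV \<tau>) \<tau> (\<lambda>z. t z i)" for i
    proof (cases "i < d")
      case True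
      have "continuous_map (prod_topology ?TV \<tau>) \<tau> ((\<lambda>p. H p i) \<circ> fst)"
        by (rule continuous_map_compose[OF continuous_map_fst H_cont[OF True]])
      then show ?thesis using True by (simp add: t_def o_def case_prod_unfold)
    next
      case False
      then show ?thesis using continuous_map_snd[of ?TV \<tau>] by (simp add: t_def case_prod_unfold)
    qed
    moreover have "polyfun (\<lambda>v. \<Sum>i<d. v i * v d ^ i)"
      by (intro polyfun_intros)
    ultimately have "continuous_map (prod_topology ?TV \<tau>) \<tau> (\<lambda>z. \<Sum>i<d. t z i * t z d ^ i)"
      by (rule polyfun_continuous[OF ft])
    then show ?thesis by (simp add: ev_def t_def case_prod_unfold poly_poly_of)
  qed
  have qV0: "q \<in> V0" using q g(2) by (simp add: V0_def D_def Q_eq G_def)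
  have Dq: "power_det d (monic_of d q) G \<noteq> 0" using qV0 by (simp add: V0_def D_def)
  define y0 where "y0 = poly G a"
  have ev_q: "ev (q, y0) = a"
    using inv_root[OF deg d Dq] root by (simp add: ev_def H_def y0_def Q_eq)
  have C_char: "monic_of d (C p) = monic_of d (char_coord d (monic_of d p) G)" for p
    by (rule monic_of_cong) (simp add: C_def)
  have "poly (monic_of d (C q)) y0 = 0"
    using char_root[OF deg d Dq] root by (simp add: C_char y0_def Q_eq)
  moreover have "C q \<notin> unstable \<tau> d" using g(3) by (simp add: C_def Q_eq G_def)
  moreover have "C q \<in> tuples d" by (simp add: C_def)
  ultimately have stable: "stable_root \<tau> d (C q) y0" by (simp add: unstable_def)
  have "stable_root \<tau> d q a"
    unfolding stable_root_def
  proof (intro allI impI)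
    fix U assume U: "openin \<tau> U \<and> a \<in> U"
    define S where "S = {z \<in> topspace (prod_topology ?TV \<tau>). ev z \<in> U}"
    have "openin (prod_topology ?TV \<tau>) S"
      unfolding S_def using U by (intro openin_continuous_preimage[OF ev_cont]) simp
    moreover have "(q, y0) \<in> S"
      using qV0 U ev_q topspace_TV by (simp add: S_def)
    ultimately obtain V1 W where VW: "openin ?TV V1" "openin \<tau> W" "q \<in> V1" "y0 \<in> W" "V1 \<times> W \<subseteq> S"
      using openin_prod_topology_alt[of ?TV \<tau> S] by blast
    obtain V2 where V2: "openin ?T V2" "C q \<in> V2" "\<forall>p'\<in>V2. \<exists>y\<in>W. poly (monic_of d p') y = 0"
      using stable VW(2,4) unfolding stable_root_def by blast
    \<comment> \<open>The condition \<open>C p \<in> V2\<close> provides a root in \<open>W\<close>,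
      and membership in \<open>V1\<close> ensures that \<open>ev\<close> sends it into
      \<open>U\<close>.\<close>
    define V where "V = V1 \<inter> {p \<in> V0. C p \<in> V2}"
    have "openin ?TV V"
      using openin_Int[OF VW(1) openin_continuous_preimage[OF C_cont V2(1)]]
      unfolding V_def topspace_TV .
    then have "openin ?T V" using openin_open_subtopology[OF V0_open] by blast
    moreover have "q \<in> V" using VW(3) qV0 V2(2) by (simp add: V_def)
    moreover have "\<exists>y\<in>U. poly (monic_of d p) y = 0" if "p \<in> V" for p
    proof -
      have p: "p \<in> V1" "D p \<noteq> 0" "C p \<in> V2" using that by (simp_all add: V_def V0_def)
      then obtain y where y: "y \<in> W" "poly (monic_of d (C p)) y = 0" using V2(3) by blast
      have "poly (monic_of d p) (ev (p, y)) = 0"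
        using root_of_char_root[OF deg d, of p G y] p(2) y(2) by (simp add: C_char ev_def H_def D_def)
      moreover have "ev (p, y) \<in> U" using VW(5) p(1) y(1) unfolding S_def by blast
      ultimately show ?thesis by blast
    qed
    ultimately show "\<exists>V. openin ?T V \<and> q \<in> V \<and> (\<forall>p'\<in>V. \<exists>y\<in>U. poly (monic_of d p') y = 0)"
      by blast
  qed
  then show ?thesis by (simp add: q_def)
qed

lemma st_henselian_topology: "st_henselian \<tau>"
  unfolding st_henselian_def
proof (intro allI impI)
  fix d Q a U
  assume Q: "Q \<in> monic_polys d \<and> separable_poly Q \<and> poly Q a = 0" and U: "openin \<tau> U \<and> a \<in> U"
  let ?c = "\<lambda>P. \<lambda>i\<in>{..<d}. Polynomial.coeff P i"
  obtain V where V: "openin (power_topology \<tau> d) V" "?c Q \<in> V"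
    "\<forall>p\<in>V. \<exists>y\<in>U. poly (monic_of d p) y = 0"
    using root_persists[of Q d a] Q U unfolding stable_root_def by blast
  have "openin (monic_poly_topology \<tau> d) (?c -` V \<inter> monic_polys d)"
    unfolding monic_poly_topology_def openin_pullback_topology using V(1) by blast
  moreover have "\<exists>b\<in>U. poly P b = 0" if "P \<in> ?c -` V \<inter> monic_polys d" for P
  proof -
    have "monic_of d (?c P) = P"
      using that monic_of_coeff[of P d] monic_of_cong[of d "?c P" "Polynomial.coeff P"] by simp
    then show ?thesis using V(3) that by force
  qed
  ultimately show "\<exists>V. openin (monic_poly_topology \<tau> d) V \<and> Q \<in> V \<and> (\<forall>P\<in>V. \<exists>b\<in>U. poly P b = 0)"
    using V(2) Q by (intro exI[of _ "?c -` V \<inter> monic_polys d"]) simp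
qed

end

theorem theorem3p12:
  fixes M :: "('f, 'r, 'm) fo_structure"
    and T :: "('f, 'r) fo_form set"
    and \<kappa> :: "'c rel"
    and e :: nat
    and \<iota> :: "'k::field \<Rightarrow> nat \<Rightarrow> 'm"
    and dim :: "nat \<Rightarrow> (nat \<Rightarrow> 'k) set \<Rightarrow> nat extended"
    and \<tau> :: "'k topology"
  assumes monster: "monster_model T \<kappa> M"
    and field: "definable_field M e \<iota>"
    and dim_range: "\<And>n A. definable_in_power M e \<iota> n A \<Longrightarrow> dim n A \<in> range Fin \<union> {-\<infinity>}"
    and dim_empty: "\<And>n A. definable_in_power M e \<iota> n A \<Longrightarrow> dim n A = -\<infinity> \<longleftrightarrow> A = {}"
    and dim_field: "dim 1 (tuples 1) > 0"
    and dim_pos: "\<And>n A. definable_in_power M e \<iota> n A \<Longrightarrow> dim n A > 0 \<Longrightarrow> infinite A"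
    and dim_prod: "\<And>n m A B. definable_in_power M e \<iota> n A \<Longrightarrow> definable_in_power M e \<iota> m B \<Longrightarrow>
      dim (n + m) (tprod n A B) = dim n A + dim m B"
    and dim_union: "\<And>n A B. definable_in_power M e \<iota> n A \<Longrightarrow> definable_in_power M e \<iota> n B \<Longrightarrow>
      dim n (A \<union> B) = max (dim n A) (dim n B)"
    and dim_finite_fibers: "\<And>n m A B f. definable_in_power M e \<iota> n A \<Longrightarrow>
      definable_in_power M e \<iota> m B \<Longrightarrow>
      definable_in_power M e \<iota> (n + m) (tgraph n A (\<lambda>x. {f x})) \<Longrightarrow>
      f ` A = B \<Longrightarrow> (\<And>y. y \<in> B \<Longrightarrow> finite {x \<in> A. f x = y}) \<Longrightarrow>
      dim n A = dim m B"
    and topology: "field_topology \<tau>" "definable_topology M e \<iota> \<tau>"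
    and dim_interior: "\<And>n A. definable_in_power M e \<iota> n A \<Longrightarrow>
      dim n A = dim n (tuples n) \<longleftrightarrow> power_topology \<tau> n interior_of A \<noteq> {}"
    and dim_discontinuity: "\<And>n m k U f. definable_in_power M e \<iota> n U \<Longrightarrow> U \<noteq> {} \<Longrightarrow>
      openin (power_topology \<tau> n) U \<Longrightarrow> correspondence k U (tuples m) f \<Longrightarrow>
      definable_in_power M e \<iota> (n + m) (tgraph n U f) \<Longrightarrow>
      dim n {a \<in> U. \<not> correspondence_continuous_at k
               (subtopology (power_topology \<tau> n) U) (power_topology \<tau> m) f a}
        < dim n (tuples n)"
  shows "st_henselian \<tau>"
proof -
  interpret field_with_dimension M e \<iota> dim \<tau>
    by unfold_locales (fact assms)+
  show ?thesis by (rule st_henselian_topology)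
qed

end
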